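(* Let $(W,S)$ be a Coxeter system with set of reflections $T$. Let $u,v\in W$ be such that $u\leq_T v$ and $\ell_T(v)=\ell_T(u)+3$. Then the interval $[u,v]_T$ is a lattice. In particular, for every Coxeter element $c$ in a Coxeter system $(W,S)$ of rank three (i.e. $|S|=3$), the poset $[1,c]_T$ of generalized noncrossing partitions is a lattice.
   Context: $(W,S)$ is a Coxeter system, where $S$ is not assumed to be finite. $T:=\bigcup_{w\in W} wSw^{-1}$ is its set of reflections, and $\ell_T:W\to\mathbb{Z}_{\geq 0}$ is the length function on $W$ with respect to the generating set $T$. The absolute order $\leq_T$ on $W$ is defined by $u\leq_T v$ if and only if $\ell_T(u)+\ell_T(u^{-1}v)=\ell_T(v)$. For $u\leq_T v$, $[u,v]_T$ denotes the poset $\{w\in W\mid u\leq_T w\leq_T v\}$ with the restriction of $\leq_T$. If $S$ is finite, a (standard) Coxeter element $c$ is the product of all the elements of $S$ in some order (each occurring exactly once), and $[1,c]_T$ is called the poset of generalized noncrossing partitions associated with $W$ and $c$. *)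

theory Defs
  imports "HOL-Algebra.Multiplicative_Group" "HOL-Algebra.Generated_Groups" "HOL-Algebra.Lattice"
begin

text \<open>
  Group words over an alphabet: the letter \<open>(a, True)\<close> stands for the generator \<open>a\<close> and
  \<open>(a, False)\<close> for its formal inverse.
\<close>

type_synonym 'a word = "('a \<times> bool) list"

definition word_value :: "('a, 'b) monoid_scheme \<Rightarrow> 'a word \<Rightarrow> 'a" where
  "word_value G w =
     foldr (\<lambda>(a, b) x. (if b then a else inv\<^bsub>G\<^esub> a) \<otimes>\<^bsub>G\<^esub> x) w \<one>\<^bsub>G\<^esub>"

text \<open>Equality of words in the group presented by generators \<open>A\<close> and relators \<open>R\<close>.\<close>

inductive presented_eq :: "'a set \<Rightarrow> 'a word set \<Rightarrow> 'a word \<Rightarrow> 'a word \<Rightarrow> bool"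
  for A :: "'a set" and R :: "'a word set" where
  refl: "w \<in> lists (A \<times> UNIV) \<Longrightarrow> presented_eq A R w w"
| sym: "presented_eq A R v w \<Longrightarrow> presented_eq A R w v"
| trans: "presented_eq A R u v \<Longrightarrow> presented_eq A R v w \<Longrightarrow> presented_eq A R u w"
| cancel: "u \<in> lists (A \<times> UNIV) \<Longrightarrow> v \<in> lists (A \<times> UNIV) \<Longrightarrow> a \<in> A \<Longrightarrow>
    presented_eq A R (u @ [(a, b), (a, \<not> b)] @ v) (u @ v)"
| relator: "u \<in> lists (A \<times> UNIV) \<Longrightarrow> v \<in> lists (A \<times> UNIV) \<Longrightarrow> r \<in> R \<Longrightarrow>
    presented_eq A R (u @ r @ v) (u @ v)"

text \<open>
  Coxeter systems as in Bourbaki (Lie IV.1.3): every element of \<open>S\<close> has order \<open>2\<close>, and \<open>W\<close> is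
  presented by the generators \<open>S\<close> and the relations \<open>(s t)\<^sup>m = 1\<close>, where \<open>m\<close> is the order of
  \<open>s t\<close> in \<open>W\<close>. The library's \<open>ord\<close> is \<open>0\<close> on elements of infinite order; the relator of such
  a pair is then the empty word, i.e. no relation is imposed.
\<close>

locale coxeter_system = group W for W :: "('a, 'b) monoid_scheme" (structure) +
  fixes S :: "'a set"
  assumes simple_closed: "S \<subseteq> carrier W"
    and simple_ord: "s \<in> S \<Longrightarrow> ord s = 2"
    and simple_generate: "generate W S = carrier W"
    and presentation: "w \<in> lists (S \<times> UNIV) \<Longrightarrow>
      word_value W w = \<one> \<longleftrightarrow>
      presented_eq S
        {concat (replicate (ord (s \<otimes> t)) [(s, True), (t, True)]) | s t. s \<in> S \<and> t \<in> S} w []"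

definition reflections :: "('a, 'b) monoid_scheme \<Rightarrow> 'a set \<Rightarrow> 'a set" where
  "reflections W S = {w \<otimes>\<^bsub>W\<^esub> s \<otimes>\<^bsub>W\<^esub> inv\<^bsub>W\<^esub> w | w s. w \<in> carrier W \<and> s \<in> S}"

text \<open>Only meaningful for \<open>x \<in> generate G A\<close>; otherwise \<open>LEAST\<close> ranges over the empty set.\<close>

definition word_length :: "('a, 'b) monoid_scheme \<Rightarrow> 'a set \<Rightarrow> 'a \<Rightarrow> nat" where
  "word_length G A x =
     (LEAST n. \<exists>w \<in> lists (A \<times> UNIV). length w = n \<and> word_value G w = x)"

definition reflection_length :: "('a, 'b) monoid_scheme \<Rightarrow> 'a set \<Rightarrow> 'a \<Rightarrow> nat" where
  "reflection_length W S = word_length W (reflections W S)"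

definition absolute_le :: "('a, 'b) monoid_scheme \<Rightarrow> 'a set \<Rightarrow> 'a \<Rightarrow> 'a \<Rightarrow> bool" where
  "absolute_le W S u v \<longleftrightarrow>
     reflection_length W S u + reflection_length W S (inv\<^bsub>W\<^esub> u \<otimes>\<^bsub>W\<^esub> v) = reflection_length W S v"

definition absolute_interval :: "('a, 'b) monoid_scheme \<Rightarrow> 'a set \<Rightarrow> 'a \<Rightarrow> 'a \<Rightarrow> 'a gorder" where
  "absolute_interval W S u v =
     \<lparr> carrier = {w \<in> carrier W. absolute_le W S u w \<and> absolute_le W S w v},
       eq = (=),
       le = absolute_le W S \<rparr>"

definition coxeter_element :: "('a, 'b) monoid_scheme \<Rightarrow> 'a set \<Rightarrow> 'a \<Rightarrow> bool" where
  "coxeter_element W S c \<longleftrightarrow>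
     (\<exists>xs. distinct xs \<and> set xs = S \<and> c = foldr (\<otimes>\<^bsub>W\<^esub>) xs \<one>\<^bsub>W\<^esub>)"

end

theory Submission
  imports Defs "HOL-Library.Poly_Mapping"
begin

text \<open>
  Let \<open>t\<^sub>1, t\<^sub>2\<close> be distinct atoms below coatoms \<open>w, w'\<close> of an interval \<open>[1, v]\<close> of rank three. Each
  coatom is a product \<open>t\<^sub>1 r\<^sub>1 = t\<^sub>2 r\<^sub>2\<close> of two reflections, so \<open>t\<^sub>1 t\<^sub>2 = r\<^sub>1 r\<^sub>2\<close>. In a reflection
  representation with a nondegenerate form an equality of this kind forces the roots of \<open>r\<^sub>1\<close> and \<open>r\<^sub>2\<close>
  into the plane of those of \<open>t\<^sub>1\<close> and \<open>t\<^sub>2\<close>. If \<open>w \<noteq> w'\<close>, the same argument puts the root of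
  \<open>s = w\<inverse> v\<close> into this plane, and \<open>v = t\<^sub>1 r\<^sub>1 s\<close> acts as the reflection in some unit vector. An
  element that acts so is a reflection, because conjugation by descents reduces it to a
  simple one; but \<open>v\<close> has reflection length three.
\<close>

section \<open>Reflections for a symmetric bilinear form\<close>

text \<open>The form of an infinite Coxeter group is in general not positive definite, so
  reflections are studied for an arbitrary symmetric form.\<close>

locale symmetric_form =
  fixes B :: "'v::real_vector \<Rightarrow> 'v \<Rightarrow> real"
  assumes form_sym: "B x y = B y x"
    and form_add_left: "B (x + y) z = B x z + B y z"
    and form_scale_left: "B (c *\<^sub>R x) z = c * B x z"
begin

lemma form_add_right: "B z (x + y) = B z x + B z y"
  by (metis form_sym form_add_left)

lemma form_scale_right: "B z (c *\<^sub>R x) = c * B z x"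
  by (metis form_sym form_scale_left)

lemma form_minus_left: "B (- x) z = - B x z"
  using form_scale_left[of "-1" x z] by simp

lemma form_minus_right: "B z (- x) = - B z x"
  by (metis form_sym form_minus_left)

lemma form_diff_left: "B (x - y) z = B x z - B y z"
  using form_add_left[of x "- y" z] by (simp add: form_minus_left)

lemma form_diff_right: "B z (x - y) = B z x - B z y"
  by (metis form_sym form_diff_left)

lemma form_zero_left: "B 0 z = 0"
  using form_scale_left[of 0 0 z] by simp

lemmas form_simps = form_add_left form_add_right form_scale_left form_scale_right
  form_minus_left form_minus_right form_diff_left form_diff_right

text \<open>The formula omits the division by \<open>B a a\<close>; it gives the orthogonal
  reflection when \<open>B a a = 1\<close>.\<close>

definition refl :: "'v \<Rightarrow> 'v \<Rightarrow> 'v" where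
  "refl a x = x - (2 * B a x) *\<^sub>R a"

lemma refl_add: "refl a (x + y) = refl a x + refl a y"
  by (simp add: refl_def form_simps algebra_simps)

lemma refl_scale: "refl a (c *\<^sub>R x) = c *\<^sub>R refl a x"
  by (simp add: refl_def form_simps algebra_simps)

lemma refl_self: "B a a = 1 \<Longrightarrow> refl a a = - a"
proof -
  assume "B a a = 1"
  then have "refl a a = a - (2::real) *\<^sub>R a" by (simp add: refl_def)
  then show ?thesis by (simp add: scaleR_2)
qed

lemma refl_refl: "B a a = 1 \<Longrightarrow> refl a (refl a x) = x"
  by (simp add: refl_def form_simps algebra_simps)

lemma refl_form: "B a a = 1 \<Longrightarrow> B (refl a x) (refl a y) = B x y"
  by (simp add: refl_def form_simps algebra_simps form_sym[of x a])

lemma refl_uminus: "refl (- a) = refl a"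
  by (rule ext) (simp add: refl_def form_simps)

lemma refl_eq_if_parallel:
  assumes "B a a = 1" "B (c *\<^sub>R a) (c *\<^sub>R a) = 1"
  shows "refl (c *\<^sub>R a) = refl a"
proof -
  have "c * c = 1" using assms by (simp add: form_simps)
  then have "c = 1 \<or> c = - 1" using square_eq_1_iff by blast
  then show ?thesis using refl_uminus[of a] by auto
qed

text \<open>In the Clifford algebra the product \<open>a b (p a + q b)\<close> of three coplanar unit vectors is
  again a unit vector, which explains the choice of the witness.\<close>

lemma refl_coplanar:
  assumes a: "B a a = 1" and b: "B b b = 1"
    and c: "B (p *\<^sub>R a + q *\<^sub>R b) (p *\<^sub>R a + q *\<^sub>R b) = 1"
  shows "\<exists>d. B d d = 1 \<and> refl a \<circ> refl b \<circ> refl (p *\<^sub>R a + q *\<^sub>R b) = refl d"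
proof -
  define k where "k = B a b"
  have ba: "B b a = k" by (simp add: k_def form_sym)
  define d where "d = (2 * p * k + q) *\<^sub>R a + (- p) *\<^sub>R b"
  have rel: "p * p + 2 * p * q * k + q * q = 1"
    using c by (simp add: form_simps a b ba flip: k_def) (simp add: algebra_simps)
  have "B d d = 1"
    using rel by (simp add: d_def form_simps a b ba algebra_simps flip: k_def)
  moreover have "refl a (refl b (refl (p *\<^sub>R a + q *\<^sub>R b) x)) = refl d x" for x
  proof -
    \<comment> \<open>The three reflections are applied from right to left and only the coefficients
      of \<open>a\<close> and \<open>b\<close> are tracked. Each final coefficient differs from that
      in \<open>refl d x\<close> by a multiple of \<open>p * p + 2 * p * q * k + q * q - 1\<close>,
      which vanishes by \<open>rel\<close>.\<close>
    define X Y G where "X = B a x" and "Y = B b x" and "G = p * X + q * Y"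
    define A C where "A = - 2 * G * p" and "C = 2 * G * q - 2 * Y + 4 * G * p * k"
    have "refl (p *\<^sub>R a + q *\<^sub>R b) x = x + A *\<^sub>R a + (- 2 * G * q) *\<^sub>R b"
      by (simp add: refl_def form_simps A_def flip: X_def Y_def G_def) (simp add: algebra_simps)
    moreover have "refl b (x + A *\<^sub>R a + (- 2 * G * q) *\<^sub>R b) = x + A *\<^sub>R a + C *\<^sub>R b"
      by (simp add: refl_def form_simps A_def C_def ba b flip: X_def Y_def)
        (simp add: algebra_simps flip: scaleR_add_left)
    moreover have "refl a (x + A *\<^sub>R a + C *\<^sub>R b) = x + (- A - 2 * X - 2 * C * k) *\<^sub>R a + C *\<^sub>R b"
    proof -
      have aux: "x + A *\<^sub>R a + C *\<^sub>R b - D *\<^sub>R a = x + (A - D) *\<^sub>R a + C *\<^sub>R b" for D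
        by (simp add: scaleR_diff_left)
      have "refl a (x + A *\<^sub>R a + C *\<^sub>R b) = x + A *\<^sub>R a + C *\<^sub>R b - (2 * (X + A + C * k)) *\<^sub>R a"
        by (simp add: refl_def form_simps a flip: X_def k_def)
      also have "\<dots> = x + (A - 2 * (X + A + C * k)) *\<^sub>R a + C *\<^sub>R b"
        by (rule aux)
      also have "A - 2 * (X + A + C * k) = - A - 2 * X - 2 * C * k" by simp
      finally show ?thesis .
    qed
    moreover have "refl d x =
        x + (- 2 * ((2 * p * k + q) * X - p * Y) * (2 * p * k + q)) *\<^sub>R a
          + (2 * ((2 * p * k + q) * X - p * Y) * p) *\<^sub>R b"
    proof -
      have "x - (2 * D) *\<^sub>R (m *\<^sub>R a + (- p) *\<^sub>R b) = x + (- 2 * D * m) *\<^sub>R a + (2 * D * p) *\<^sub>R b" for D m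
        by (simp add: scaleR_add_right scaleR_diff_right)
      moreover have "B d x = (2 * p * k + q) * X - p * Y"
        by (simp add: d_def form_simps flip: X_def Y_def)
      ultimately show ?thesis by (simp only: refl_def d_def)
    qed
    moreover have C: "C = 2 * ((2 * p * k + q) * X - p * Y) * p"
    proof -
      have "C - 2 * ((2 * p * k + q) * X - p * Y) * p = 2 * Y * (p * p + 2 * p * q * k + q * q - 1)"
        unfolding C_def G_def by (simp add: algebra_simps)
      then show ?thesis by (simp add: rel)
    qed
    moreover have "- A - 2 * X - 2 * C * k = - 2 * ((2 * p * k + q) * X - p * Y) * (2 * p * k + q)"
    proof -
      have "- A - 2 * X - 2 * C * k - - 2 * ((2 * p * k + q) * X - p * Y) * (2 * p * k + q)
          = 2 * X * (p * p + 2 * p * q * k + q * q - 1)"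
        unfolding A_def C G_def by (simp add: algebra_simps)
      then show ?thesis by (simp only: rel diff_self mult_zero_right right_minus_eq)
    qed
    ultimately show ?thesis by simp
  qed
  ultimately show ?thesis by (metis comp_apply ext)
qed

end

section \<open>Chebyshev polynomials and products of two reflections\<close>

text \<open>In terms of Chebyshev polynomials of the second kind, \<open>cheb c k\<close> is
  U_(k-1)(c/2). These are the coefficients of the roots of a dihedral group in its two simple
  roots.\<close>

fun cheb :: "real \<Rightarrow> nat \<Rightarrow> real" where
  "cheb c 0 = 0"
| "cheb c (Suc 0) = 1"
| "cheb c (Suc (Suc k)) = c * cheb c (Suc k) - cheb c k"

text \<open>This is the case of infinite order, where the quotient of sines in
  \<open>cheb_cos\<close> degenerates.\<close>

lemma cheb_two: "cheb 2 k = real k"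
  by (induction "2::real" k rule: cheb.induct) auto

lemma cheb_cos:
  assumes "sin \<theta> \<noteq> 0"
  shows "cheb (2 * cos \<theta>) k = sin (real k * \<theta>) / sin \<theta>"
proof (induction "2 * cos \<theta>" k rule: cheb.induct)
  case (3 k)
  have "sin (real (Suc (Suc k)) * \<theta>) = sin (real (Suc k) * \<theta> + \<theta>)"
       "sin (real k * \<theta>) = sin (real (Suc k) * \<theta> - \<theta>)"
    by (simp_all add: algebra_simps)
  then have "sin (real (Suc (Suc k)) * \<theta>)
      = 2 * cos \<theta> * sin (real (Suc k) * \<theta>) - sin (real k * \<theta>)"
    unfolding sin_add sin_diff by simp
  with 3 show ?case by (simp add: diff_divide_distrib)
qed (use assms in auto)

text \<open>Infinite order is encoded by \<open>m = 0\<close>, and then \<open>pi / m = 0\<close>.\<close>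

lemma cheb_nonneg:
  assumes "m \<noteq> 1" "m = 0 \<or> k \<le> m"
  shows "0 \<le> cheb (2 * cos (pi / real m)) k"
proof (cases "m = 0")
  case True
  then show ?thesis by (simp add: cheb_two)
next
  case False
  then have m: "m \<ge> 2" and k: "k \<le> m" using assms by auto
  have "0 < pi / m" "pi / m < pi" using m by (auto simp: field_simps)
  then have "0 < sin (pi / m)" using sin_gt_zero by blast
  moreover have "0 \<le> sin (k * (pi / m))"
    by (rule sin_ge_zero) (use m k in \<open>auto simp: field_simps\<close>)
  ultimately show ?thesis by (subst cheb_cos) auto
qed

context symmetric_form
begin

fun alt_refl :: "'v \<Rightarrow> 'v \<Rightarrow> nat \<Rightarrow> 'v \<Rightarrow> 'v" where
  "alt_refl a b 0 x = x"
| "alt_refl a b (Suc k) x = refl (if even k then b else a) (alt_refl a b k x)"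

text \<open>Each reflection negates its own root and adds \<open>c\<close> times that root to the
  other one; on the pair of coefficients this is the Chebyshev recurrence.\<close>

lemma alt_refl_root:
  assumes "B a a = 1" "B b b = 1" "c = - 2 * B a b"
  shows "alt_refl a b k a = cheb c (Suc k) *\<^sub>R (if even k then a else b)
           + cheb c k *\<^sub>R (if even k then b else a)"
proof (induction k)
  case (Suc k)
  have "B b a = B a b" by (rule form_sym)
  then have ab: "refl a b = b + c *\<^sub>R a" "refl b a = a + c *\<^sub>R b"
    using assms(3) by (simp_all add: refl_def)
  show ?case
    by (simp add: Suc refl_add refl_scale refl_self assms(1,2) ab) (simp add: algebra_simps)
qed simp

lemma alt_refl_even: "alt_refl a b (2 * n) x = ((refl a \<circ> refl b) ^^ n) x"
  by (induction n) auto

lemma funpow_inverse: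
  assumes "\<And>x. f (g x) = x" "\<And>x. g (f x) = x" "(f ^^ n) x = x"
  shows "(g ^^ n) x = x"
proof -
  have "(g ^^ n) ((f ^^ n) x) = x" for x
    by (induction n arbitrary: x) (auto simp: funpow_swap1 assms(1,2))
  then show ?thesis using assms(3) by metis
qed

text \<open>The product of the two reflections is a rotation by \<open>2 * pi / m\<close> in the
  plane of \<open>a\<close> and \<open>b\<close> and fixes the orthogonal complement. The form is
  nondegenerate on this plane because the sine of \<open>pi / m\<close> is nonzero, so every vector
  splits accordingly.\<close>

lemma refl_dihedral:
  assumes a: "B a a = 1" and b: "B b b = 1" and ab: "B a b = - cos (pi / real m)" and m: "m \<ge> 2"
  shows "((refl a \<circ> refl b) ^^ m) x = x"
proof -
  have "0 < pi / m" "pi / m < pi" using m by (auto simp: field_simps)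
  then have sn: "0 < sin (pi / m)" using sin_gt_zero by blast
  have root: "((refl a' \<circ> refl b') ^^ m) a' = a'"
    if "B a' a' = 1" "B b' b' = 1" "B a' b' = - cos (pi / real m)" for a' b'
  proof -
    \<comment> \<open>After \<open>2 * m\<close> reflections the angle is a full turn, and the
      coefficients of \<open>a'\<close> and \<open>b'\<close> return to one and zero.\<close>
    have "real (2 * m) * (pi / m) = 2 * pi" "real (Suc (2 * m)) * (pi / m) = pi / m + 2 * pi"
      using m by (simp_all add: field_simps)
    moreover have "sin (pi / m + 2 * pi) = sin (pi / m)" by (rule sin_periodic)
    ultimately have "cheb (2 * cos (pi / m)) (2 * m) = 0" "cheb (2 * cos (pi / m)) (Suc (2 * m)) = 1"
      using sn by (subst cheb_cos; simp del: of_nat_mult of_nat_Suc)+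
    then show ?thesis
      using alt_refl_root[of a' b' "2 * cos (pi / m)" "2 * m"] that by (simp add: alt_refl_even)
  qed
  let ?f = "(refl a \<circ> refl b) ^^ m"
  have fa: "?f a = a" using root[OF a b ab] .
  \<comment> \<open>By symmetry the inverse rotation fixes \<open>b\<close>, hence so does the
    rotation itself.\<close>
  have "((refl b \<circ> refl a) ^^ m) b = b" using root[OF b a] ab form_sym by metis
  then have fb: "?f b = b"
    by (rule funpow_inverse[rotated 2]) (simp_all add: refl_refl a b)
  define k where "k = B a b"
  have ba: "B b a = k" by (simp add: k_def form_sym)
  have k1: "1 - k * k \<noteq> 0"
    using sn sin_cos_squared_add[of "pi / m"] by (auto simp: k_def ab power2_eq_square)
  \<comment> \<open>These coefficients solve the linear system that makes \<open>y\<close>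
    orthogonal to \<open>a\<close> and \<open>b\<close>; its determinant is
    \<open>1 - k * k\<close>, the squared sine of \<open>pi / m\<close>.\<close>
  define p q where "p = (B a x - k * B b x) / (1 - k * k)" and "q = (B b x - k * B a x) / (1 - k * k)"
  define y where "y = x - p *\<^sub>R a - q *\<^sub>R b"
  have "B a y = B a x - p - q * k" "B b y = B b x - p * k - q"
    by (simp_all add: y_def form_simps a b ba flip: k_def)
  moreover have "B a x - p - q * k = 0" "B b x - p * k - q = 0"
    using k1 by (simp_all add: p_def q_def divide_simps) (simp_all add: algebra_simps)
  ultimately have "refl a y = y" "refl b y = y" by (simp_all add: refl_def)
  then have fy: "?f y = y" by (induction m) auto
  have lin: "((refl a \<circ> refl b) ^^ n) (u + c *\<^sub>R v)
      = ((refl a \<circ> refl b) ^^ n) u + c *\<^sub>R ((refl a \<circ> refl b) ^^ n) v" for n u c v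
    by (induction n) (auto simp: refl_add refl_scale)
  have "x = y + p *\<^sub>R a + q *\<^sub>R b" by (simp add: y_def)
  then show ?thesis by (metis lin fa fb fy)
qed

end

section \<open>Finitely supported vectors, which allow infinite \<open>S\<close>, and forms given by
  a matrix\<close>

instantiation poly_mapping :: (type, real_vector) real_vector
begin

lift_definition scaleR_poly_mapping :: "real \<Rightarrow> ('a \<Rightarrow>\<^sub>0 'b) \<Rightarrow> 'a \<Rightarrow>\<^sub>0 'b" is
  "\<lambda>c f i. c *\<^sub>R f i"
  by (erule rev_finite_subset) auto

instance
  by standard (transfer; auto simp: algebra_simps)+

end

lemma lookup_scaleR: "Poly_Mapping.lookup (c *\<^sub>R x) i = c *\<^sub>R Poly_Mapping.lookup x i"
  by transfer simp

abbreviation coord :: "('i \<Rightarrow>\<^sub>0 real) \<Rightarrow> 'i \<Rightarrow> real" where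
  "coord \<equiv> Poly_Mapping.lookup"

definition matrix_form :: "('i \<Rightarrow> 'i \<Rightarrow> real) \<Rightarrow> ('i \<Rightarrow>\<^sub>0 real) \<Rightarrow> ('i \<Rightarrow>\<^sub>0 real) \<Rightarrow> real" where
  "matrix_form c x y = (\<Sum>i\<in>Poly_Mapping.keys x. \<Sum>j\<in>Poly_Mapping.keys y. coord x i * c i j * coord y j)"

text \<open>Cancellation can shrink the support of a sum, so bilinearity is proved by summing over
  common larger index sets.\<close>

lemma matrix_form_eq:
  assumes "finite A" "Poly_Mapping.keys x \<subseteq> A" "finite C" "Poly_Mapping.keys y \<subseteq> C"
  shows "matrix_form c x y = (\<Sum>i\<in>A. \<Sum>j\<in>C. coord x i * c i j * coord y j)"
proof -
  have "matrix_form c x y = (\<Sum>i\<in>Poly_Mapping.keys x. \<Sum>j\<in>C. coord x i * c i j * coord y j)"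
    unfolding matrix_form_def using assms
    by (intro sum.cong sum.mono_neutral_left) (auto simp: in_keys_iff)
  also have "\<dots> = (\<Sum>i\<in>A. \<Sum>j\<in>C. coord x i * c i j * coord y j)"
    using assms by (intro sum.mono_neutral_left) (auto simp: in_keys_iff)
  finally show ?thesis .
qed

lemma symmetric_form_matrix:
  assumes "\<And>i j. c i j = c j i"
  shows "symmetric_form (matrix_form c)"
proof
  show "matrix_form c x y = matrix_form c y x" for x y
    unfolding matrix_form_def by (subst sum.swap) (auto intro!: sum.cong simp: assms mult_ac)
  show "matrix_form c (x + y) z = matrix_form c x z + matrix_form c y z" for x y z
  proof -
    let ?A = "Poly_Mapping.keys x \<union> Poly_Mapping.keys y"
    have "Poly_Mapping.keys (x + y) \<subseteq> ?A" by (rule keys_add)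
    then show ?thesis
      by (simp add: matrix_form_eq[of ?A _ "Poly_Mapping.keys z" z] lookup_add distrib_right sum.distrib)
  qed
  show "matrix_form c (r *\<^sub>R x) z = r * matrix_form c x z" for r x z
  proof -
    have "Poly_Mapping.keys (r *\<^sub>R x) \<subseteq> Poly_Mapping.keys x" by (auto simp: in_keys_iff lookup_scaleR)
    then show ?thesis
      by (simp add: matrix_form_eq[of "Poly_Mapping.keys x" _ "Poly_Mapping.keys z" z] lookup_scaleR sum_distrib_left mult.assoc)
  qed
qed

lemma matrix_form_single_right:
  "matrix_form c x (Poly_Mapping.single j 1) = (\<Sum>i\<in>Poly_Mapping.keys x. coord x i * c i j)"
  by (subst matrix_form_eq[of "Poly_Mapping.keys x" _ "{j}"]) auto

lemma matrix_form_single: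
  "matrix_form c (Poly_Mapping.single i 1) (Poly_Mapping.single j 1) = c i j"
  by (subst matrix_form_eq[of "{i}" _ "{j}"]) auto

section \<open>Groups generated by involutions\<close>

text \<open>Minimal upper bounds of \<open>x, y\<close> are unique when the poset contains no crossing
  \<open>x, y \<le> z, z'\<close>; the rank guarantees that they exist.\<close>

lemma lattice_if_no_crossing:
  fixes L :: "('a, 'b) gorder_scheme" (structure) and r :: "'a \<Rightarrow> nat"
  assumes po: "partial_order L"
    and bot: "b \<in> carrier L" "\<And>x. x \<in> carrier L \<Longrightarrow> b \<sqsubseteq> x"
    and top: "t \<in> carrier L" "\<And>x. x \<in> carrier L \<Longrightarrow> x \<sqsubseteq> t"
    and rank: "\<And>x y. \<lbrakk>x \<in> carrier L; y \<in> carrier L; x \<sqsubseteq> y; x \<noteq> y\<rbrakk> \<Longrightarrow> r x < r y"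
    and no_crossing: "\<And>x y z z'. \<lbrakk>x \<in> carrier L; y \<in> carrier L; z \<in> carrier L; z' \<in> carrier L;
        x \<sqsubseteq> z; y \<sqsubseteq> z; x \<sqsubseteq> z'; y \<sqsubseteq> z'; \<not> x \<sqsubseteq> y; \<not> y \<sqsubseteq> x; \<not> z \<sqsubseteq> z'; \<not> z' \<sqsubseteq> z\<rbrakk> \<Longrightarrow> False"
  shows "lattice L"
proof -
  interpret partial_order L by fact
  have sup: "\<exists>s\<in>carrier L. x \<sqsubseteq> s \<and> y \<sqsubseteq> s \<and> (\<forall>z\<in>carrier L. x \<sqsubseteq> z \<and> y \<sqsubseteq> z \<longrightarrow> s \<sqsubseteq> z)"
    if x: "x \<in> carrier L" and y: "y \<in> carrier L" for x y
  proof (cases "x \<sqsubseteq> y \<or> y \<sqsubseteq> x")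
    case True
    then show ?thesis using x y by blast
  next
    case False
    let ?U = "\<lambda>z. z \<in> carrier L \<and> x \<sqsubseteq> z \<and> y \<sqsubseteq> z"
    have "?U t" using top x y by blast
    then obtain s where s: "?U s" "\<And>z. ?U z \<Longrightarrow> r s \<le> r z"
      using ex_has_least_nat[of ?U t r] by blast
    \<comment> \<open>An upper bound of minimal rank that is not below \<open>z\<close> cannot be
      above \<open>z\<close> either, and the crossing \<open>x\<close>, \<open>y\<close>,
      \<open>s\<close>, \<open>z\<close> arises.\<close>
    have "s \<sqsubseteq> z" if z: "?U z" for z
    proof (rule ccontr)
      assume n: "\<not> s \<sqsubseteq> z"
      then have "\<not> z \<sqsubseteq> s" using s z rank[of z s] by (metis leD le_refl)
      then show False using no_crossing[of x y s z] False n s z x y by blast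
    qed
    then show ?thesis using s by blast
  qed
  have inf: "\<exists>s\<in>carrier L. s \<sqsubseteq> x \<and> s \<sqsubseteq> y \<and> (\<forall>z\<in>carrier L. z \<sqsubseteq> x \<and> z \<sqsubseteq> y \<longrightarrow> z \<sqsubseteq> s)"
    if x: "x \<in> carrier L" and y: "y \<in> carrier L" for x y
  proof (cases "x \<sqsubseteq> y \<or> y \<sqsubseteq> x")
    case True
    then show ?thesis using x y by blast
  next
    case False
    let ?U = "\<lambda>z. z \<in> carrier L \<and> z \<sqsubseteq> x \<and> z \<sqsubseteq> y"
    have "?U b" using bot x y by blast
    \<comment> \<open>Minimising the distance to \<open>r t\<close> maximises the rank; the
      subtraction of naturals is harmless since \<open>r z \<le> r t\<close> on the carrier.\<close>
    then obtain s where s: "?U s" "\<And>z. ?U z \<Longrightarrow> r t - r s \<le> r t - r z"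
      using ex_has_least_nat[of ?U b "\<lambda>z. r t - r z"] by blast
    have le_t: "r z \<le> r t" if "z \<in> carrier L" for z
      using that top rank[of z t] by (cases "z = t") auto
    have "z \<sqsubseteq> s" if z: "?U z" for z
    proof (rule ccontr)
      assume n: "\<not> z \<sqsubseteq> s"
      have "r z \<le> r s" using s(2)[OF z] le_t[of z] le_t[of s] s(1) z by linarith
      then have "\<not> s \<sqsubseteq> z" using s z n rank[of s z] by (metis leD le_refl)
      then show False using no_crossing[of s z x y] False n s z x y by blast
    qed
    then show ?thesis using s by blast
  qed
  show ?thesis
  proof
    fix x y assume xy: "x \<in> carrier L" "y \<in> carrier L"
    obtain s where "s \<in> carrier L" "x \<sqsubseteq> s" "y \<sqsubseteq> s"
      "\<And>z. z \<in> carrier L \<Longrightarrow> x \<sqsubseteq> z \<Longrightarrow> y \<sqsubseteq> z \<Longrightarrow> s \<sqsubseteq> z"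
      using sup[OF xy] by blast
    then have "least L s (Upper L {x, y})"
      unfolding least_def Upper_def using xy by auto
    then show "\<exists>s. least L s (Upper L {x, y})" by blast
    obtain s where "s \<in> carrier L" "s \<sqsubseteq> x" "s \<sqsubseteq> y"
      "\<And>z. z \<in> carrier L \<Longrightarrow> z \<sqsubseteq> x \<Longrightarrow> z \<sqsubseteq> y \<Longrightarrow> z \<sqsubseteq> s"
      using inf[OF xy] by blast
    then have "greatest L s (Lower L {x, y})"
      unfolding greatest_def Lower_def using xy by auto
    then show "\<exists>s. greatest L s (Lower L {x, y})" by blast
  qed
qed

section \<open>Word length with respect to a generating set of involutions\<close>

definition list_product :: "('a, 'b) monoid_scheme \<Rightarrow> 'a list \<Rightarrow> 'a" where
  "list_product G xs = foldr (\<otimes>\<^bsub>G\<^esub>) xs \<one>\<^bsub>G\<^esub>"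

text \<open>This is instantiated both with the simple generators and with all reflections, so that
  the two length functions share one theory.\<close>

locale involution_generated = group G for G :: "('a, 'b) monoid_scheme" (structure) +
  fixes A :: "'a set"
  assumes gens_closed: "A \<subseteq> carrier G"
    and gens_involution: "a \<in> A \<Longrightarrow> a \<otimes> a = \<one>"
    and gens_generate: "generate G A = carrier G"
begin

abbreviation len :: "'a \<Rightarrow> nat" where
  "len \<equiv> word_length G A"

lemma gen_in_carrier [simp]: "a \<in> A \<Longrightarrow> a \<in> carrier G"
  using gens_closed by blast

lemma inv_cancel_left: "x \<in> carrier G \<Longrightarrow> y \<in> carrier G \<Longrightarrow> x \<otimes> (inv x \<otimes> y) = y"
  by (simp flip: m_assoc)

lemma gen_inv: "a \<in> A \<Longrightarrow> inv a = a"
  using gens_involution inv_equality by simp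

lemma gen_cancel_right: "a \<in> A \<Longrightarrow> x \<in> carrier G \<Longrightarrow> x \<otimes> a \<otimes> a = x"
  by (simp add: m_assoc gens_involution)

lemma gen_cancel_left: "a \<in> A \<Longrightarrow> x \<in> carrier G \<Longrightarrow> a \<otimes> (a \<otimes> x) = x"
  by (metis gen_in_carrier gens_involution l_one m_assoc)

lemma list_product_Nil [simp]: "list_product G [] = \<one>"
  by (simp add: list_product_def)

lemma list_product_Cons [simp]: "list_product G (x # xs) = x \<otimes> list_product G xs"
  by (simp add: list_product_def)

lemma list_product_closed [simp]: "set xs \<subseteq> A \<Longrightarrow> list_product G xs \<in> carrier G"
  by (induction xs) auto

lemma list_product_append:
  "set xs \<subseteq> A \<Longrightarrow> set ys \<subseteq> A \<Longrightarrow> list_product G (xs @ ys) = list_product G xs \<otimes> list_product G ys"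
  by (induction xs) (auto simp: m_assoc)

lemma list_product_rev: "set xs \<subseteq> A \<Longrightarrow> list_product G (rev xs) = inv (list_product G xs)"
  by (induction xs) (auto simp: list_product_append inv_mult_group gen_inv)

lemma word_value_positive: "word_value G (map (\<lambda>a. (a, True)) xs) = list_product G xs"
  by (induction xs) (auto simp: word_value_def)

lemma word_value_list_product:
  "w \<in> lists (A \<times> UNIV) \<Longrightarrow> word_value G w = list_product G (map fst w)"
  by (induction w) (auto simp: word_value_def gen_inv)

lemma list_product_ex: "x \<in> carrier G \<Longrightarrow> \<exists>xs. set xs \<subseteq> A \<and> list_product G xs = x"
  unfolding gens_generate[symmetric]
proof (induction rule: generate.induct)
  case one
  then show ?case by (intro exI[of _ "[]"]) simp
next
  case (incl a)
  then show ?case by (intro exI[of _ "[a]"]) simp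
next
  case (inv a)
  then show ?case by (intro exI[of _ "[a]"]) (simp add: gen_inv)
next
  case (eng x y)
  then show ?case by (metis list_product_append set_append Un_least)
qed

lemma len_le: "set xs \<subseteq> A \<Longrightarrow> len (list_product G xs) \<le> length xs"
  unfolding word_length_def
  by (rule Least_le, rule bexI[of _ "map (\<lambda>a. (a, True)) xs"])
    (auto simp: word_value_positive)

lemma len_witness:
  assumes "x \<in> carrier G"
  obtains xs where "set xs \<subseteq> A" "length xs = len x" "list_product G xs = x"
proof -
  obtain ys where "set ys \<subseteq> A" "list_product G ys = x"
    using list_product_ex assms by blast
  then have "\<exists>n. \<exists>w\<in>lists (A \<times> UNIV). length w = n \<and> word_value G w = x"
    by (intro exI[of _ "length ys"] bexI[of _ "map (\<lambda>a. (a, True)) ys"])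
      (auto simp: word_value_positive)
  then obtain w where "w \<in> lists (A \<times> UNIV)" "length w = len x" "word_value G w = x"
    unfolding word_length_def by (rule LeastI_ex[THEN bexE]) blast
  then show thesis
    by (intro that[of "map fst w"]) (auto simp: word_value_list_product)
qed

lemma len_one [simp]: "len \<one> = 0"
  using len_le[of "[]"] by simp

lemma len_eq_0_iff: "x \<in> carrier G \<Longrightarrow> len x = 0 \<longleftrightarrow> x = \<one>"
  by (metis len_one len_witness length_0_conv list_product_Nil)

lemma len_mult: "x \<in> carrier G \<Longrightarrow> y \<in> carrier G \<Longrightarrow> len (x \<otimes> y) \<le> len x + len y"
  by (metis len_le len_witness length_append list_product_append set_append Un_least)

lemma len_inv: "x \<in> carrier G \<Longrightarrow> len (inv x) = len x"
proof -
  have "len (inv x) \<le> len x" if "x \<in> carrier G" for x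
    by (metis that len_le len_witness length_rev list_product_rev set_rev)
  then show "x \<in> carrier G \<Longrightarrow> len (inv x) = len x"
    by (metis inv_closed inv_inv le_antisym)
qed

lemma len_gen: "a \<in> A \<Longrightarrow> len a \<le> 1"
  using len_le[of "[a]"] by simp

lemma len_mult_gen: "a \<in> A \<Longrightarrow> x \<in> carrier G \<Longrightarrow> len (x \<otimes> a) \<le> Suc (len x)"
  using len_mult[of x a] len_gen[of a] by simp

lemma len_mult_gen_ge: "a \<in> A \<Longrightarrow> x \<in> carrier G \<Longrightarrow> len x \<le> Suc (len (x \<otimes> a))"
  using len_mult_gen[of a "x \<otimes> a"] by (simp add: gen_cancel_right)

lemma len_gen_mult:
  assumes "a \<in> A" "x \<in> carrier G"
  shows "len (a \<otimes> x) = len (inv x \<otimes> a)"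
  using len_inv[of "inv x \<otimes> a"] assms by (simp add: inv_mult_group gen_inv)

lemma len_eq_1:
  assumes "x \<in> carrier G" "len x = 1"
  shows "x \<in> A"
proof -
  obtain xs where xs: "set xs \<subseteq> A" "length xs = 1" "list_product G xs = x"
    using len_witness[OF assms(1)] assms(2) by metis
  then obtain a where "xs = [a]" by (cases xs) auto
  with xs show ?thesis by auto
qed

lemma len_descent:
  assumes "x \<in> carrier G" "x \<noteq> \<one>"
  obtains a where "a \<in> A" "len (x \<otimes> a) < len x"
proof -
  obtain xs where xs: "set xs \<subseteq> A" "length xs = len x" "list_product G xs = x"
    using len_witness[OF assms(1)] by metis
  then have "xs \<noteq> []" using assms by auto
  then obtain ys a where ya: "xs = ys @ [a]" by (metis rev_exhaust)
  then have "x \<otimes> a = list_product G ys" using xs by (auto simp: list_product_append gen_cancel_right)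
  moreover have "len (list_product G ys) \<le> length ys" using xs ya by (intro len_le) auto
  ultimately show thesis using that[of a] xs ya by auto
qed

section \<open>The prefix order, which is the absolute order when the generators are the
  reflections\<close>

definition prefix_le :: "'a \<Rightarrow> 'a \<Rightarrow> bool" where
  "prefix_le x y \<longleftrightarrow> len x + len (inv x \<otimes> y) = len y"

lemma prefix_le_refl: "x \<in> carrier G \<Longrightarrow> prefix_le x x"
  by (simp add: prefix_le_def)

lemma prefix_le_one: "x \<in> carrier G \<Longrightarrow> prefix_le \<one> x"
  by (simp add: prefix_le_def)

lemma prefix_le_eq:
  assumes "x \<in> carrier G" "y \<in> carrier G" "prefix_le x y" "len y \<le> len x"
  shows "x = y"
proof -
  have "len (inv x \<otimes> y) = 0" using assms by (simp add: prefix_le_def)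
  then have "inv x \<otimes> y = \<one>" using assms by (simp add: len_eq_0_iff)
  then show ?thesis using assms by (metis inv_closed inv_equality inv_inv)
qed

lemma prefix_le_trans:
  assumes [simp]: "x \<in> carrier G" "y \<in> carrier G" "z \<in> carrier G"
    and "prefix_le x y" "prefix_le y z"
  shows "prefix_le x z"
proof -
  have "inv x \<otimes> z = (inv x \<otimes> y) \<otimes> (inv y \<otimes> z)" by (simp add: m_assoc inv_cancel_left)
  then have "len (inv x \<otimes> z) \<le> len (inv x \<otimes> y) + len (inv y \<otimes> z)" by (simp add: len_mult)
  moreover have "z = x \<otimes> (inv x \<otimes> z)" by (simp add: inv_cancel_left)
  then have "len z \<le> len x + len (inv x \<otimes> z)" by (metis assms(1,3) inv_closed len_mult m_closed)
  ultimately show ?thesis using assms(4,5) by (simp add: prefix_le_def)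
qed

lemma prefix_le_cover:
  assumes [simp]: "x \<in> carrier G" "y \<in> carrier G" and "prefix_le x y" "len y = Suc (len x)"
  obtains a where "a \<in> A" "y = x \<otimes> a"
proof -
  have "len (inv x \<otimes> y) = 1" using assms(3,4) by (simp add: prefix_le_def)
  then have "inv x \<otimes> y \<in> A" by (simp add: len_eq_1)
  moreover have "y = x \<otimes> (inv x \<otimes> y)" by (simp add: inv_cancel_left)
  ultimately show thesis using that by blast
qed

definition prefix_interval :: "'a \<Rightarrow> 'a \<Rightarrow> 'a gorder" where
  "prefix_interval u v =
     \<lparr>carrier = {w \<in> carrier G. prefix_le u w \<and> prefix_le w v}, eq = (=), le = prefix_le\<rparr>"

lemma partial_order_prefix_interval: "partial_order (prefix_interval u v)"
proof -
  have "x = y" if "x \<in> carrier G" "y \<in> carrier G" "prefix_le x y" "prefix_le y x" for x y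
    by (rule prefix_le_eq[OF that(1-3)]) (use that(4) in \<open>simp add: prefix_le_def\<close>)
  then show ?thesis
    by unfold_locales (auto simp: prefix_interval_def prefix_le_refl intro: prefix_le_trans)
qed

text \<open>A crossing has two members strictly above \<open>u\<close> and, strictly above these,
  two members strictly below \<open>v\<close>. Rank at most three then leaves only two atoms below
  two coatoms, which \<open>unique\<close> excludes.\<close>

lemma lattice_prefix_interval:
  assumes [simp]: "u \<in> carrier G" "v \<in> carrier G"
    and uv: "prefix_le u v" and rank: "len v \<le> len u + 3"
    and unique: "\<And>a b w w'. \<lbrakk>a \<in> carrier G; b \<in> carrier G; w \<in> carrier G; w' \<in> carrier G;
        prefix_le u a; prefix_le u b; len a = Suc (len u); len b = Suc (len u); a \<noteq> b;
        prefix_le a w; prefix_le b w; prefix_le a w'; prefix_le b w'; prefix_le w v; prefix_le w' v;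
        len w = Suc (Suc (len u)); len w' = Suc (Suc (len u)); len v = Suc (Suc (Suc (len u)))\<rbrakk>
      \<Longrightarrow> w = w'"
  shows "lattice (prefix_interval u v)"
proof (rule lattice_if_no_crossing[where r = len])
  show "partial_order (prefix_interval u v)" by (rule partial_order_prefix_interval)
  show "u \<in> carrier (prefix_interval u v)" "v \<in> carrier (prefix_interval u v)"
    using uv by (auto simp: prefix_interval_def prefix_le_refl)
  show "u \<sqsubseteq>\<^bsub>prefix_interval u v\<^esub> x" "x \<sqsubseteq>\<^bsub>prefix_interval u v\<^esub> v" if "x \<in> carrier (prefix_interval u v)" for x
    using that by (auto simp: prefix_interval_def)
  have less: "len x < len y" if "x \<in> carrier G" "y \<in> carrier G" "prefix_le x y" "x \<noteq> y" for x y
    using that prefix_le_eq[of x y] by fastforce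
  then show "len x < len y" if "x \<in> carrier (prefix_interval u v)" "y \<in> carrier (prefix_interval u v)"
    "x \<sqsubseteq>\<^bsub>prefix_interval u v\<^esub> y" "x \<noteq> y" for x y
    using that by (auto simp: prefix_interval_def)
  fix x y z z'
  assume "x \<in> carrier (prefix_interval u v)" "y \<in> carrier (prefix_interval u v)"
    "z \<in> carrier (prefix_interval u v)" "z' \<in> carrier (prefix_interval u v)"
  then have C: "x \<in> carrier G" "y \<in> carrier G" "z \<in> carrier G" "z' \<in> carrier G"
    and U: "prefix_le u x" "prefix_le u y" "prefix_le u z" "prefix_le u z'"
    and V: "prefix_le x v" "prefix_le y v" "prefix_le z v" "prefix_le z' v"
    by (auto simp: prefix_interval_def)
  assume "x \<sqsubseteq>\<^bsub>prefix_interval u v\<^esub> z" "y \<sqsubseteq>\<^bsub>prefix_interval u v\<^esub> z"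
    "x \<sqsubseteq>\<^bsub>prefix_interval u v\<^esub> z'" "y \<sqsubseteq>\<^bsub>prefix_interval u v\<^esub> z'"
  then have L: "prefix_le x z" "prefix_le y z" "prefix_le x z'" "prefix_le y z'"
    by (auto simp: prefix_interval_def)
  assume "\<not> x \<sqsubseteq>\<^bsub>prefix_interval u v\<^esub> y" "\<not> y \<sqsubseteq>\<^bsub>prefix_interval u v\<^esub> x"
    "\<not> z \<sqsubseteq>\<^bsub>prefix_interval u v\<^esub> z'" "\<not> z' \<sqsubseteq>\<^bsub>prefix_interval u v\<^esub> z"
  then have N: "\<not> prefix_le x y" "\<not> prefix_le y x" "\<not> prefix_le z z'" "\<not> prefix_le z' z"
    by (auto simp: prefix_interval_def)
  then have ne: "x \<noteq> u" "y \<noteq> u" "z \<noteq> v" "z' \<noteq> v" "x \<noteq> z" "x \<noteq> z'" "y \<noteq> z" "y \<noteq> z'" "x \<noteq> y" "z \<noteq> z'"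
    using U V L C by (auto simp: prefix_le_refl)
  have "len u < len x" "len u < len y" "len x < len z" "len y < len z" "len x < len z'" "len y < len z'"
    "len z < len v" "len z' < len v"
    using less U V L C ne by auto
  then have "len x = Suc (len u)" "len y = Suc (len u)" "len z = Suc (Suc (len u))"
    "len z' = Suc (Suc (len u))" "len v = Suc (Suc (Suc (len u)))"
    using rank by linarith+
  then show False using unique[of x y z z'] C U V L ne by blast
qed

end

section \<open>The geometric representation\<close>

context coxeter_system
begin

sublocale simple: involution_generated W S
proof
  show "s \<otimes> s = \<one>" if "s \<in> S" for s
    using that simple_closed simple_ord pow_ord_eq_1[of s] by (auto simp: numeral_2_eq_2)
qed (simp_all add: simple_closed simple_generate)

abbreviation "relators \<equiv>
  {concat (replicate (ord (s \<otimes> t)) [(s, True), (t, True)]) | s t. s \<in> S \<and> t \<in> S}"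

lemma ord_commute: "s \<in> S \<Longrightarrow> t \<in> S \<Longrightarrow> ord (s \<otimes> t) = ord (t \<otimes> s)"
  using ord_inv[of "s \<otimes> t"] by (simp add: inv_mult_group simple.gen_inv)

lemma ord_self: "s \<in> S \<Longrightarrow> ord (s \<otimes> s) = 1"
  by (simp add: simple.gens_involution)

lemma ord_distinct:
  assumes "s \<in> S" "t \<in> S" "s \<noteq> t"
  shows "ord (s \<otimes> t) \<noteq> 1"
proof
  assume "ord (s \<otimes> t) = 1"
  then have "s \<otimes> t = \<one>" using assms ord_eq_1 by simp
  then have "s = t" using assms by (metis simple.gen_in_carrier simple.gen_inv inv_equality)
  then show False using assms by simp
qed

text \<open>The usual form lives on the coordinates marked \<open>True\<close>. It may be degenerate, so it is
  paired with a second copy of the space, marked \<open>False\<close>; since the quotient by zero is zero,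
  infinite order gives the entry \<open>-1\<close>.\<close>

definition gram :: "'a \<times> bool \<Rightarrow> 'a \<times> bool \<Rightarrow> real" where
  "gram i j =
     (if snd i \<and> snd j
      then if fst i \<in> S \<and> fst j \<in> S then - cos (pi / real (ord (fst i \<otimes> fst j))) else 0
      else if snd i \<noteq> snd j \<and> fst i = fst j then 1 else 0)"

abbreviation form :: "('a \<times> bool \<Rightarrow>\<^sub>0 real) \<Rightarrow> ('a \<times> bool \<Rightarrow>\<^sub>0 real) \<Rightarrow> real" where
  "form \<equiv> matrix_form gram"

sublocale geo: symmetric_form form
  by (rule symmetric_form_matrix) (auto simp: gram_def ord_commute)

definition root :: "'a \<Rightarrow> ('a \<times> bool \<Rightarrow>\<^sub>0 real)" where
  "root s = Poly_Mapping.single (s, True) 1"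

lemma form_root: "s \<in> S \<Longrightarrow> t \<in> S \<Longrightarrow> form (root s) (root t) = - cos (pi / real (ord (s \<otimes> t)))"
  by (simp add: root_def matrix_form_single gram_def)

text \<open>The product \<open>s \<otimes> s\<close> has order one and \<open>- cos pi = 1\<close>,
  so the diagonal entries come from the same formula as the others.\<close>

lemma form_root_self [simp]: "s \<in> S \<Longrightarrow> form (root s) (root s) = 1"
  by (simp add: form_root ord_self)

definition act :: "'a list \<Rightarrow> ('a \<times> bool \<Rightarrow>\<^sub>0 real) \<Rightarrow> ('a \<times> bool \<Rightarrow>\<^sub>0 real)" where
  "act xs = foldr (\<lambda>s f. geo.refl (root s) \<circ> f) xs id"

lemma act_Nil [simp]: "act [] = id"
  by (simp add: act_def)

lemma act_Cons [simp]: "act (s # xs) = geo.refl (root s) \<circ> act xs"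
  by (simp add: act_def)

lemma act_append: "act (xs @ ys) = act xs \<circ> act ys"
  by (induction xs) auto

lemma act_rev: "set xs \<subseteq> S \<Longrightarrow> act (rev xs) (act xs x) = x"
  by (induction xs arbitrary: x) (auto simp: act_append geo.refl_refl)

lemma act_relator:
  assumes "s \<in> S" "t \<in> S"
  shows "act (map fst (concat (replicate (ord (s \<otimes> t)) [(s, True), (t, True)]))) = id"
proof -
  have *: "act (map fst (concat (replicate n [(s, True), (t, True)])))
      = (geo.refl (root s) \<circ> geo.refl (root t)) ^^ n" for n
    by (induction n) auto
  show ?thesis
  proof (cases "s = t \<or> ord (s \<otimes> t) = 0")
    case True
    \<comment> \<open>For \<open>s = t\<close> the relator is the word \<open>s s\<close>; for
      infinite order it is empty.\<close>
    then show ?thesis using assms by (auto simp: fun_eq_iff ord_self geo.refl_refl)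
  next
    case False
    then have "ord (s \<otimes> t) \<ge> 2" using ord_distinct[OF assms] by simp
    then show ?thesis
      unfolding * using geo.refl_dihedral[of "root s" "root t"] assms by (auto simp: form_root ord_self)
  qed
qed

lemma act_presented: "presented_eq S relators v w \<Longrightarrow> act (map fst v) = act (map fst w)"
proof (induction rule: presented_eq.induct)
  case (cancel u v a b)
  then show ?case by (auto simp: act_append geo.refl_refl fun_eq_iff)
next
  case (relator u v r)
  then have "act (map fst r) = id" using act_relator by auto
  then show ?case by (simp add: act_append)
qed auto

text \<open>All relators have even length, so the parity of a word is an invariant of its value;
  this is the sign character of \<open>W\<close>.\<close>

lemma even_presented: "presented_eq S relators v w \<Longrightarrow> even (length v) = even (length w)"
proof (induction rule: presented_eq.induct)
  case (relator u v r)
  have "even (length (concat (replicate n [a, b])))" for n and a b :: "'a \<times> bool"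
    by (induction n) auto
  with relator have "even (length r)" by blast
  then show ?case by simp
qed auto

lemma presented_one:
  assumes "set xs \<subseteq> S" "list_product W xs = \<one>"
  shows "presented_eq S relators (map (\<lambda>a. (a, True)) xs) []"
  using assms by (subst presentation[symmetric]) (auto simp: simple.word_value_positive)

lemma
  assumes "set xs \<subseteq> S" "set ys \<subseteq> S" "list_product W xs = list_product W ys"
  shows act_eq: "act xs = act ys"
    and even_eq: "even (length xs) = even (length ys)"
proof -
  have "list_product W (xs @ rev ys) = \<one>"
    using assms by (simp add: simple.list_product_append simple.list_product_rev)
  then have p: "presented_eq S relators (map (\<lambda>a. (a, True)) (xs @ rev ys)) []"
    using assms by (intro presented_one) auto
  have "act (xs @ rev ys) = id"
    using act_presented[OF p] by (simp add: comp_def)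
  then show "act xs = act ys"
    using assms(2) act_rev[of ys] by (simp add: act_append fun_eq_iff) metis
  show "even (length xs) = even (length ys)"
    using even_presented[OF p] by simp
qed

text \<open>The choice of the word is immaterial by \<open>act_eq\<close>, which rests on the
  presentation.\<close>

definition rep :: "'a \<Rightarrow> ('a \<times> bool \<Rightarrow>\<^sub>0 real) \<Rightarrow> ('a \<times> bool \<Rightarrow>\<^sub>0 real)" where
  "rep w = act (SOME xs. set xs \<subseteq> S \<and> list_product W xs = w)"

lemma rep_list_product:
  assumes "set xs \<subseteq> S"
  shows "rep (list_product W xs) = act xs"
proof -
  let ?P = "\<lambda>ys. set ys \<subseteq> S \<and> list_product W ys = list_product W xs"
  have "?P (SOME ys. ?P ys)" by (rule someI[of ?P xs]) (use assms in simp)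
  then show ?thesis unfolding rep_def using act_eq assms by blast
qed

lemma rep_one [simp]: "rep \<one> = id"
  using rep_list_product[of "[]"] by simp

lemma rep_simple: "s \<in> S \<Longrightarrow> rep s = geo.refl (root s)"
  using rep_list_product[of "[s]"] by simp

lemma rep_mult: "v \<in> carrier W \<Longrightarrow> w \<in> carrier W \<Longrightarrow> rep (v \<otimes> w) = rep v \<circ> rep w"
  by (metis simple.list_product_ex rep_list_product act_append simple.list_product_append
      set_append Un_least)

lemma rep_inv: "w \<in> carrier W \<Longrightarrow> rep w (rep (inv w) x) = x"
  using rep_mult[of w "inv w"] by (simp add: fun_eq_iff)

lemma act_add: "act xs (x + y) = act xs x + act xs y"
  by (induction xs) (auto simp: geo.refl_add)

lemma act_scale: "act xs (c *\<^sub>R x) = c *\<^sub>R act xs x"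
  by (induction xs) (auto simp: geo.refl_scale)

lemma act_form: "set xs \<subseteq> S \<Longrightarrow> form (act xs x) (act xs y) = form x y"
  by (induction xs) (auto simp: geo.refl_form)

lemma rep_add: "rep w (x + y) = rep w x + rep w y"
  by (simp add: rep_def act_add)

lemma rep_scale: "rep w (c *\<^sub>R x) = c *\<^sub>R rep w x"
  by (simp add: rep_def act_scale)

lemma rep_minus: "rep w (- x) = - rep w x"
  using rep_scale[of w "-1" x] by simp

lemma rep_form: "w \<in> carrier W \<Longrightarrow> form (rep w x) (rep w y) = form x y"
  by (metis act_form rep_list_product simple.list_product_ex)

lemma rep_conj:
  assumes "w \<in> carrier W" "x \<in> carrier W" "rep x = geo.refl a"
  shows "rep (w \<otimes> x \<otimes> inv w) = geo.refl (rep w a)"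
proof
  fix y
  have "form a (rep (inv w) y) = form (rep w a) y"
    using rep_form[OF assms(1), of a "rep (inv w) y"] by (simp add: rep_inv assms(1))
  then have "rep w (geo.refl a (rep (inv w) y)) = geo.refl (rep w a) y"
    using rep_add[of w "rep (inv w) y" "- ((2 * form a (rep (inv w) y)) *\<^sub>R a)"]
    by (simp add: geo.refl_def rep_minus rep_scale rep_inv assms(1))
  then show "rep (w \<otimes> x \<otimes> inv w) y = geo.refl (rep w a) y"
    using assms by (simp add: rep_mult)
qed

section \<open>Ascents, descents and the signs of roots\<close>

lemma len_mult_simple_ne:
  assumes "w \<in> carrier W" "s \<in> S"
  shows "simple.len (w \<otimes> s) \<noteq> simple.len w"
proof
  assume eq: "simple.len (w \<otimes> s) = simple.len w"
  obtain xs where xs: "set xs \<subseteq> S" "length xs = simple.len w" "list_product W xs = w"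
    using simple.len_witness assms by blast
  obtain ys where ys: "set ys \<subseteq> S" "length ys = simple.len (w \<otimes> s)" "list_product W ys = w \<otimes> s"
    using simple.len_witness[of "w \<otimes> s"] assms by auto
  have "list_product W (xs @ [s]) = list_product W ys"
    using xs ys assms by (simp add: simple.list_product_append)
  then have "even (length (xs @ [s])) = even (length ys)"
    using xs ys assms by (intro even_eq) auto
  then show False using xs ys eq by simp
qed

text \<open>Zero counts as positive, so every contradiction between signs has to come from a nonzero
  coordinate.\<close>

definition positive :: "('a \<times> bool \<Rightarrow>\<^sub>0 real) \<Rightarrow> bool" where
  "positive x \<longleftrightarrow> (\<forall>i. 0 \<le> coord x i)"

lemma positive_root: "positive (root s)"
  by (simp add: positive_def root_def lookup_single when_def)

lemma positive_combination:
  "positive x \<Longrightarrow> positive y \<Longrightarrow> 0 \<le> a \<Longrightarrow> 0 \<le> b \<Longrightarrow> positive (a *\<^sub>R x + b *\<^sub>R y)"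
  by (simp add: positive_def lookup_add lookup_scaleR)

text \<open>Right multiplication by this alternating product strips from an element, letter by
  letter, an alternating suffix that ends in \<open>t\<close>.\<close>

fun walk :: "'a \<Rightarrow> 'a \<Rightarrow> nat \<Rightarrow> 'a" where
  "walk s t 0 = \<one>"
| "walk s t (Suc k) = walk s t k \<otimes> (if even k then t else s)"

lemma walk_closed [simp]: "s \<in> S \<Longrightarrow> t \<in> S \<Longrightarrow> walk s t k \<in> carrier W"
  by (induction k) auto

lemma walk_even: "s \<in> S \<Longrightarrow> t \<in> S \<Longrightarrow> walk s t (2 * n) = (t \<otimes> s) [^] n"
  by (induction n) (auto simp: m_assoc)

text \<open>Each new letter of the walk cancels the newest reflection of \<open>alt_refl\<close>.
  This expresses the image of a root under \<open>w\<close> by the images, under the stripped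
  element, of the two simple roots.\<close>

lemma rep_walk:
  assumes "w \<in> carrier W" "s \<in> S" "t \<in> S"
  shows "rep (w \<otimes> walk s t k) (geo.alt_refl (root s) (root t) k x) = rep w x"
proof (induction k)
  case (Suc k)
  define a where "a = (if even k then t else s)"
  have a: "a \<in> S" using assms by (simp add: a_def)
  have "w \<otimes> walk s t (Suc k) = (w \<otimes> walk s t k) \<otimes> a"
    using assms a by (simp add: a_def m_assoc)
  moreover have "geo.alt_refl (root s) (root t) (Suc k) x
      = geo.refl (root a) (geo.alt_refl (root s) (root t) k x)"
    by (simp add: a_def)
  moreover have "rep ((w \<otimes> walk s t k) \<otimes> a) = rep (w \<otimes> walk s t k) \<circ> geo.refl (root a)"
    using assms a by (simp add: rep_mult rep_simple comp_assoc)
  ultimately show ?case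
    using a by (simp add: geo.refl_refl Suc del: walk.simps geo.alt_refl.simps)
qed (use assms in simp)

text \<open>Strip from \<open>w\<close> its longest alternating suffix in \<open>s\<close> and the last letter \<open>t\<close>; the rest sends
  both simple roots to positive vectors, and the suffix has fewer than \<open>ord (s t)\<close> letters since
  otherwise it could be chosen to end in \<open>s\<close>.\<close>

lemma positive_if_ascent:
  assumes "w \<in> carrier W" "s \<in> S" "simple.len w < simple.len (w \<otimes> s)"
  shows "positive (rep w (root s))"
  using assms
proof (induction "simple.len w" arbitrary: w s rule: less_induct)
  case less
  note w = less.prems(1) and s = less.prems(2)
  show ?case
  proof (cases "w = \<one>")
    case False
    then obtain t where t: "t \<in> S" "simple.len (w \<otimes> t) < simple.len w"
      using simple.len_descent w by blast
    have st: "s \<noteq> t" using t less.prems by auto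
    define x where "x k = (if even k then t else s)" for k :: nat
    define u where "u k = w \<otimes> walk s t k" for k
    have x: "x k \<in> S" for k using s t by (simp add: x_def)
    have u: "u k \<in> carrier W" for k using w s t by (simp add: u_def)
    have u_Suc: "u (Suc k) = u k \<otimes> x k" for k
      using w s t by (simp add: u_def x_def m_assoc)
    have u0: "u 0 = w" using w by (simp add: u_def)
    have step: "simple.len (u k) \<le> Suc (simple.len (u (Suc k)))"
      "simple.len (u (Suc k)) \<le> Suc (simple.len (u k))" for k
      unfolding u_Suc using simple.len_mult_gen_ge simple.len_mult_gen u x by auto
    have lower: "simple.len w \<le> simple.len (u k) + k" for k
    proof (induction k)
      case (Suc k)
      then show ?case using step(1)[of k] by linarith
    qed (simp add: u0)
    have upper: "simple.len (u (k + i)) \<le> simple.len (u k) + i" for k i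
    proof (induction i)
      case (Suc i)
      then show ?case using step(2)[of "k + i"] by simp
    qed simp
    \<comment> \<open>\<open>P k\<close> says that every one of the first \<open>k\<close> stripped
      letters shortens the element.\<close>
    define P where "P k \<longleftrightarrow> simple.len (u k) + k = simple.len w" for k
    have P_down: "P j" if "P k" "j \<le> k" for j k
      using that(2,1)
    proof (induction rule: inc_induct)
      case (step n)
      then show ?case using lower[of n] \<open>\<And>k. simple.len (u k) \<le> Suc (simple.len (u (Suc k)))\<close>[of n]
        by (simp add: P_def)
    qed simp
    have "u 1 = w \<otimes> t" using w t by (simp add: u_def)
    then have P1: "P 1" using t lower[of 1] by (simp add: P_def)
    have bound: "k \<le> simple.len w" if "P k" for k using that by (simp add: P_def)
    define k where "k = (GREATEST k. P k)"
    have Pk: "P k" unfolding k_def by (rule GreatestI_nat[where P = P, OF P1 bound])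
    have max: "j \<le> k" if "P j" for j unfolding k_def by (rule Greatest_le_nat[where P = P, OF that bound])
    then obtain j where j: "k = Suc j" using P1 by (cases k) force+
    define v where "v = u k"
    have v: "v \<in> carrier W" using u by (simp add: v_def)
    have len_v: "simple.len v + k = simple.len w" using Pk by (simp add: P_def v_def)
    \<comment> \<open>By maximality of \<open>k\<close> the next letter does not shorten
      \<open>v\<close>, and parity excludes equal lengths; it is an ascent of
      \<open>v\<close>.\<close>
    have "\<not> P (Suc k)" using max not_less_eq_eq by blast
    then have "simple.len v < simple.len (v \<otimes> x k)"
      using len_mult_simple_ne[OF v x[of k]] step(1)[of k] len_v
      by (simp add: P_def u_Suc flip: v_def)
    then have pos_k: "positive (rep v (root (x k)))"
      using less.hyps v x len_v j by simp
    \<comment> \<open>The letter stripped last is an ascent of \<open>v\<close> too. Since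
      \<open>k\<close> is positive, \<open>v\<close> is shorter than \<open>w\<close> and the
      induction hypothesis applies to both letters.\<close>
    have "v \<otimes> x j = u j" using u x by (simp add: v_def j u_Suc simple.gen_cancel_right)
    then have "simple.len v < simple.len (v \<otimes> x j)" using lower[of j] len_v j by simp
    then have pos_j: "positive (rep v (root (x j)))"
      using less.hyps v x len_v j by simp
    define m where "m = ord (s \<otimes> t)"
    \<comment> \<open>If \<open>0 < m \<le> k\<close>, the first \<open>m\<close> letters shorten
      \<open>w\<close>. The walk of \<open>2 * m\<close> letters is trivial and its last letter is
      \<open>s\<close>, so one letter earlier it has reached \<open>w \<otimes> s\<close>. The
      remaining \<open>m - 1\<close> letters cannot make up for the loss, and
      \<open>w \<otimes> s\<close> would be shorter than \<open>w\<close>.\<close>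
    have m: "m = 0 \<or> Suc k \<le> m"
    proof (rule ccontr)
      assume "\<not> ?thesis"
      then have "P m" "m \<noteq> 0" using P_down[OF Pk] by auto
      then obtain i where i: "m = Suc i" by (cases m) auto
      have "walk s t (2 * m) = \<one>"
        using s t pow_ord_eq_1[of "t \<otimes> s"] by (simp add: walk_even m_def ord_commute del: pow_ord_eq_1)
      then have "u (Suc (m + i)) = w" using w by (simp add: u_def i mult_2 del: walk.simps)
      then have "u (m + i) \<otimes> s = w" by (simp add: u_Suc x_def i)
      then have "u (m + i) = w \<otimes> s" using simple.gen_cancel_right[OF s u, of "m + i"] by simp
      then show False using upper[of m i] \<open>P m\<close> less.prems(3) by (simp add: P_def i)
    qed
    have m1: "m \<noteq> 1" using ord_distinct s t st by (simp add: m_def)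
    let ?c = "2 * cos (pi / real m)"
    have c: "0 \<le> cheb ?c (Suc k)" "0 \<le> cheb ?c k"
      using cheb_nonneg[OF m1] m by auto
    have "geo.alt_refl (root s) (root t) k (root s)
        = cheb ?c (Suc k) *\<^sub>R root (x j) + cheb ?c k *\<^sub>R root (x k)"
      using s t by (subst geo.alt_refl_root[of _ _ ?c]) (auto simp: form_root m_def x_def j)
    then have "rep w (root s) = cheb ?c (Suc k) *\<^sub>R rep v (root (x j)) + cheb ?c k *\<^sub>R rep v (root (x k))"
      using rep_walk[OF w s t(1), of k "root s"] by (simp add: rep_add rep_scale v_def u_def)
    then show ?thesis using positive_combination pos_j pos_k c by simp
  qed (simp add: positive_root)
qed

lemma negative_if_descent:
  assumes "w \<in> carrier W" "s \<in> S" "simple.len (w \<otimes> s) < simple.len w"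
  shows "positive (- rep w (root s))"
proof -
  have "positive (rep (w \<otimes> s) (root s))"
    using assms by (intro positive_if_ascent) (auto simp: simple.gen_cancel_right)
  then show ?thesis
    using assms by (simp add: rep_mult rep_simple geo.refl_self rep_minus)
qed

text \<open>A nontrivial \<open>w\<close> has a descent, whose simple root it makes negative, while
  the identity keeps it positive.\<close>

lemma rep_eq_id:
  assumes "w \<in> carrier W" "rep w = id"
  shows "w = \<one>"
proof (rule ccontr)
  assume "w \<noteq> \<one>"
  then obtain s where "s \<in> S" "simple.len (w \<otimes> s) < simple.len w"
    using simple.len_descent assms by blast
  then have "positive (- root s)" using negative_if_descent assms by fastforce
  then have "0 \<le> coord (- root s) (s, True)" unfolding positive_def by blast
  then show False by (simp add: root_def)
qed

lemma rep_inj: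
  assumes "v \<in> carrier W" "w \<in> carrier W" "rep v = rep w"
  shows "v = w"
proof -
  have "rep (v \<otimes> inv w) = id"
    using assms by (auto simp: rep_mult rep_inv)
  then have "v \<otimes> inv w = \<one>" using rep_eq_id assms by simp
  then show ?thesis using assms by (metis inv_closed inv_equality inv_inv)
qed

section \<open>Reflections and the absolute order\<close>

lemma reflections_closed: "reflections W S \<subseteq> carrier W"
  by (auto simp: reflections_def)

lemma simple_reflection: "s \<in> S \<Longrightarrow> s \<in> reflections W S"
  unfolding reflections_def by (force intro: exI[of _ "\<one>"])

lemma reflections_conj:
  assumes "r \<in> reflections W S" "w \<in> carrier W"
  shows "w \<otimes> r \<otimes> inv w \<in> reflections W S"
proof -
  obtain v s where "v \<in> carrier W" "s \<in> S" "r = v \<otimes> s \<otimes> inv v"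
    using assms unfolding reflections_def by blast
  then have "w \<otimes> r \<otimes> inv w = (w \<otimes> v) \<otimes> s \<otimes> inv (w \<otimes> v)" "w \<otimes> v \<in> carrier W"
    using assms(2) by (simp_all add: m_assoc inv_mult_group)
  then show ?thesis using \<open>s \<in> S\<close> unfolding reflections_def by blast
qed

sublocale absolute: involution_generated W "reflections W S"
proof
  show "reflections W S \<subseteq> carrier W" by (rule reflections_closed)
  show "r \<otimes> r = \<one>" if r: "r \<in> reflections W S" for r
  proof -
    obtain w s where ws: "w \<in> carrier W" "s \<in> S" "r = w \<otimes> s \<otimes> inv w"
      using r unfolding reflections_def by blast
    then have "r \<otimes> r = w \<otimes> (s \<otimes> (inv w \<otimes> (w \<otimes> (s \<otimes> inv w))))"
      by (simp add: m_assoc)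
    also have "\<dots> = \<one>"
      using ws by (simp add: simple.gen_cancel_left flip: m_assoc[of "inv w" w])
    finally show ?thesis .
  qed
  have "generate W S \<subseteq> generate W (reflections W S)"
    by (rule mono_generate) (use simple_reflection in blast)
  then show "generate W (reflections W S) = carrier W"
    using generate_in_carrier[OF reflections_closed] simple_generate by blast
qed

text \<open>Conjugating by a descent \<open>s\<close> of \<open>w\<close> shortens \<open>w\<close> unless \<open>w = s\<close>.\<close>

lemma reflection_if_rep:
  assumes "w \<in> carrier W" "rep w = geo.refl d" "form d d = 1"
  shows "w \<in> reflections W S"
  using assms
proof (induction "simple.len w" arbitrary: w d rule: less_induct)
  case less
  note w = less.prems(1) and d = less.prems(2,3)
  have "w \<noteq> \<one>"
  proof
    assume "w = \<one>"
    then have "d = - d" using d geo.refl_self by (metis id_apply rep_one)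
    then have "form d d = - form d d" using geo.form_minus_right[of d d] by simp
    then show False using d(2) by simp
  qed
  then obtain s where s: "s \<in> S" and desc: "simple.len (w \<otimes> s) < simple.len w"
    using simple.len_descent w by blast
  define b where "b = rep w (root s)"
  have neg: "positive (- b)" unfolding b_def by (rule negative_if_descent[OF w s desc])
  have sw: "s \<otimes> w \<in> carrier W" and sws: "s \<otimes> w \<otimes> s \<in> carrier W" using s w by auto
  \<comment> \<open>By faithfulness \<open>w\<close> is an involution, so the right descent
    \<open>s\<close> is also a left descent.\<close>
  have "rep (w \<otimes> w) = id" using w d by (auto simp: rep_mult geo.refl_refl)
  then have "w \<otimes> w = \<one>" using rep_eq_id w by simp
  then have inv_w: "inv w = w" using inv_equality w by simp
  then have len_sw: "simple.len (s \<otimes> w) < simple.len w"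
    using simple.len_gen_mult s w desc by simp
  show ?case
  proof (cases "\<exists>i. i \<noteq> (s, True) \<and> coord b i \<noteq> 0")
    case True
    then obtain i where i: "i \<noteq> (s, True)" "coord b i \<noteq> 0" by blast
    \<comment> \<open>The reflection in \<open>root s\<close> changes only the coordinate at
      \<open>(s, True)\<close>, so the strictly negative coordinate of \<open>b\<close> at
      \<open>i\<close> survives. Thus \<open>s\<close> is not an ascent of
      \<open>s \<otimes> w\<close>.\<close>
    have "simple.len (s \<otimes> w \<otimes> s) < simple.len w"
    proof (rule ccontr)
      assume "\<not> ?thesis"
      then have "positive (rep (s \<otimes> w) (root s))"
        using len_sw sw s by (intro positive_if_ascent) auto
      then have "positive (geo.refl (root s) b)"
        using s w by (simp add: rep_mult rep_simple b_def)
      then have "0 \<le> coord (geo.refl (root s) b) i" unfolding positive_def by blast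
      also have "coord (geo.refl (root s) b) i = coord b i"
        using i by (auto simp: geo.refl_def lookup_minus lookup_scaleR root_def lookup_single when_def)
      finally have "0 \<le> coord b i" .
      moreover have "0 \<le> coord (- b) i" using neg unfolding positive_def by blast
      ultimately show False using i by simp
    qed
    moreover have "rep (s \<otimes> w \<otimes> s) = geo.refl (geo.refl (root s) d)"
      using rep_conj[of s w d] s w d by (simp add: rep_simple simple.gen_inv)
    moreover have "form (geo.refl (root s) d) (geo.refl (root s) d) = 1"
      using s d by (simp add: geo.refl_form)
    ultimately have "s \<otimes> w \<otimes> s \<in> reflections W S"
      using less.hyps sws by blast
    then have "s \<otimes> (s \<otimes> w \<otimes> s) \<otimes> inv s \<in> reflections W S"
      using reflections_conj s by simp
    then show ?thesis
      using s w by (simp add: simple.gen_inv m_assoc simple.gen_cancel_left simple.gens_involution)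
  next
    case False
    \<comment> \<open>Now \<open>b\<close> is a negative unit vector on the line of
      \<open>root s\<close>, so \<open>w\<close> negates \<open>root s\<close>. As \<open>w\<close>
      acts by \<open>refl d\<close>, this puts \<open>root s\<close> on the line of
      \<open>d\<close>, and faithfulness gives \<open>w = s\<close>.\<close>
    define c where "c = coord b (s, True)"
    have b: "b = c *\<^sub>R root s"
    proof (rule poly_mapping_eqI)
      fix i
      have "coord b i = 0" if "i \<noteq> (s, True)" using False that by blast
      then show "coord b i = coord (c *\<^sub>R root s) i"
        by (cases "i = (s, True)") (simp_all add: c_def lookup_scaleR root_def lookup_single when_def)
    qed
    have "form b b = 1" unfolding b_def using rep_form w s by simp
    then have "c * c = 1" using s by (simp add: b geo.form_simps)
    then have "c = 1 \<or> c = - 1" using square_eq_1_iff by blast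
    moreover have "0 \<le> coord (- b) (s, True)" using neg unfolding positive_def by blast
    ultimately have "c = - 1" by (auto simp: c_def)
    then have "root s - (2 * form d (root s)) *\<^sub>R d = - root s"
      using b d by (simp add: b_def geo.refl_def)
    then have "(2::real) *\<^sub>R root s = (2 * form d (root s)) *\<^sub>R d"
      by (simp add: algebra_simps scaleR_2)
    then have "root s = form d (root s) *\<^sub>R d"
      by (metis scaleR_left_imp_eq scaleR_scaleR zero_neq_numeral)
    then have "geo.refl (root s) = geo.refl d"
      using geo.refl_eq_if_parallel[of d "form d (root s)"] d s by simp
    then have "rep w = rep s" using d s by (simp add: rep_simple)
    then have "w = s" using rep_inj w s by simp
    then show ?thesis using s simple_reflection by simp
  qed
qed

section \<open>Separation of roots and equal products of two reflections\<close>

text \<open>These vectors form the first copy of the space, in which all roots lie.\<close>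

definition flat :: "('a \<times> bool \<Rightarrow>\<^sub>0 real) \<Rightarrow> bool" where
  "flat x \<longleftrightarrow> (\<forall>t. coord x (t, False) = 0)"

lemma flat_root: "flat (root s)"
  by (simp add: flat_def root_def lookup_single)

lemma flat_act: "flat x \<Longrightarrow> flat (act xs x)"
proof (induction xs)
  case (Cons s xs)
  then have "flat (act xs x)" by blast
  then have "flat (geo.refl (root s) (act xs x))"
    using flat_root[of s] by (simp add: flat_def geo.refl_def lookup_minus lookup_scaleR)
  then show ?case by simp
qed simp

lemma reflection_root:
  assumes "r \<in> reflections W S"
  obtains a where "flat a" "form a a = 1" "rep r = geo.refl a"
proof -
  obtain w s where ws: "w \<in> carrier W" "s \<in> S" "r = w \<otimes> s \<otimes> inv w"
    using assms unfolding reflections_def by blast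
  have "flat (rep w (root s))" unfolding rep_def by (rule flat_act[OF flat_root])
  moreover have "form (rep w (root s)) (rep w (root s)) = 1" using rep_form ws by simp
  moreover have "rep r = geo.refl (rep w (root s))" using rep_conj rep_simple ws by simp
  ultimately show thesis using that by blast
qed

text \<open>The second copy provides dual basis vectors; pairing with them makes up for a degenerate
  form on the first copy.\<close>

lemma form_dual_coordinate: "form x (Poly_Mapping.single (t, False) 1) = coord x (t, True)"
proof -
  have "form x (Poly_Mapping.single (t, False) 1)
      = (\<Sum>i\<in>Poly_Mapping.keys x. if i = (t, True) then coord x i else 0)"
    unfolding matrix_form_single_right by (rule sum.cong) (auto simp: gram_def)
  also have "\<dots> = coord x (t, True)" by (simp add: in_keys_iff)
  finally show ?thesis .
qed

text \<open>Vectors that are not parallel have a nonzero two by two minor \<open>D\<close> of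
  coordinates, and Cramer's rule in the dual basis vectors gives \<open>p\<close>.\<close>

lemma form_separates:
  assumes "flat a" "flat b" "b \<noteq> 0" "\<And>c. a \<noteq> c *\<^sub>R b"
  obtains p where "form a p = 1" "form b p = 0"
proof -
  have flat_eqI: "x = y" if "flat x" "flat y" "\<And>t. coord x (t, True) = coord y (t, True)" for x y
  proof (rule poly_mapping_eqI)
    fix k :: "'a \<times> bool"
    obtain t e where "k = (t, e)" by fastforce
    with that show "coord x k = coord y k" by (cases e) (simp_all add: flat_def)
  qed
  have "flat 0" by (simp add: flat_def)
  then obtain j where j: "coord b (j, True) \<noteq> 0"
    using flat_eqI[OF assms(2)] assms(3) by fastforce
  obtain i where i: "coord a (i, True) * coord b (j, True) \<noteq> coord a (j, True) * coord b (i, True)"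
  proof (rule ccontr)
    assume "\<not> thesis"
    then have e: "coord a (i, True) * coord b (j, True) = coord a (j, True) * coord b (i, True)" for i
      using that by blast
    have "a = (coord a (j, True) / coord b (j, True)) *\<^sub>R b"
    proof (rule flat_eqI[OF assms(1)])
      show "flat ((coord a (j, True) / coord b (j, True)) *\<^sub>R b)"
        using assms(2) by (simp add: flat_def lookup_scaleR)
      show "coord a (i, True) = coord ((coord a (j, True) / coord b (j, True)) *\<^sub>R b) (i, True)" for i
        using e[of i] j by (simp add: lookup_scaleR divide_simps)
    qed
    then show False using assms(4) by blast
  qed
  define D where "D = coord a (i, True) * coord b (j, True) - coord a (j, True) * coord b (i, True)"
  have D: "D \<noteq> 0" using i by (simp add: D_def)
  let ?p = "(coord b (j, True) / D) *\<^sub>R Poly_Mapping.single (i, False) 1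
      - (coord b (i, True) / D) *\<^sub>R Poly_Mapping.single (j, False) (1::real)"
  have "form a ?p = (coord a (i, True) * coord b (j, True) - coord a (j, True) * coord b (i, True)) / D"
    by (simp add: geo.form_simps form_dual_coordinate diff_divide_distrib mult.commute)
  then have "form a ?p = 1" using D by (simp flip: D_def)
  moreover have "form b ?p = 0" by (simp add: geo.form_simps form_dual_coordinate)
  ultimately show thesis using that by blast
qed

text \<open>Both sides are evaluated at a vector \<open>x\<close> orthogonal to \<open>d\<close>
  with \<open>form c x = 1\<close>: the left side moves it by a multiple of \<open>c\<close>, the
  right side by a combination of \<open>a\<close> and \<open>b\<close>.\<close>

lemma reflection_product_plane:
  assumes "flat c" "flat d" "d \<noteq> 0" "\<And>r. c \<noteq> r *\<^sub>R d"
    and eq: "geo.refl c \<circ> geo.refl d = geo.refl a \<circ> geo.refl b"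
  obtains p q where "c = p *\<^sub>R a + q *\<^sub>R b"
proof -
  obtain x where x: "form c x = 1" "form d x = 0" using form_separates assms(1-4) by blast
  define y z where "y = form b x" and "z = form a (geo.refl b x)"
  have "geo.refl c (geo.refl d x) = x - (2::real) *\<^sub>R c" using x by (simp add: geo.refl_def)
  moreover have "geo.refl a (geo.refl b x) = x - (2 * y) *\<^sub>R b - (2 * z) *\<^sub>R a"
    unfolding geo.refl_def[of a] z_def[symmetric] by (simp add: geo.refl_def y_def)
  ultimately have "x - (2::real) *\<^sub>R c = x - (2 * y) *\<^sub>R b - (2 * z) *\<^sub>R a"
    using eq by (metis comp_apply)
  then have "(2::real) *\<^sub>R c = (2::real) *\<^sub>R (z *\<^sub>R a + y *\<^sub>R b)"
    by (simp add: algebra_simps)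
  then have "c = z *\<^sub>R a + y *\<^sub>R b" by (metis scaleR_left_imp_eq zero_neq_numeral)
  then show thesis using that by blast
qed

lemma reflection_roots_independent:
  assumes "r \<in> carrier W" "s \<in> carrier W" "rep r = geo.refl a" "rep s = geo.refl b"
    and "form a a = 1" "form b b = 1" "r \<noteq> s"
  shows "a \<noteq> c *\<^sub>R b"
proof
  assume "a = c *\<^sub>R b"
  then have "geo.refl a = geo.refl b" using geo.refl_eq_if_parallel[of b c] assms(5,6) by simp
  then show False using rep_inj[of r s] assms by simp
qed

lemma reflection_product_eq:
  assumes T: "r \<in> carrier W" "s \<in> carrier W" "t \<in> carrier W" "t' \<in> carrier W"
    and rep: "rep r = geo.refl a" "rep s = geo.refl b" "rep t = geo.refl c" "rep t' = geo.refl d"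
    and unit: "form c c = 1" "form d d = 1" and flat: "flat c" "flat d"
    and ne: "t \<noteq> t'" and eq: "t \<otimes> t' = r \<otimes> s"
  obtains p q where "c = p *\<^sub>R a + q *\<^sub>R b"
proof (rule reflection_product_plane[OF flat])
  show "d \<noteq> 0" using unit geo.form_zero_left by auto
  show "c \<noteq> x *\<^sub>R d" for x
    using reflection_roots_independent T rep unit ne by blast
  show "geo.refl c \<circ> geo.refl d = geo.refl a \<circ> geo.refl b"
    using eq rep rep_mult T by metis
qed (use that in blast)

text \<open>All the roots involved lie in the plane spanned by those of \<open>t\<^sub>1\<close> and \<open>t\<^sub>2\<close>.\<close>

lemma reflection_if_crossing:
  assumes T: "t\<^sub>1 \<in> reflections W S" "t\<^sub>2 \<in> reflections W S" "r\<^sub>1 \<in> reflections W S" "r\<^sub>2 \<in> reflections W S"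
      "q\<^sub>1 \<in> reflections W S" "q\<^sub>2 \<in> reflections W S" "s \<in> reflections W S" "s' \<in> reflections W S"
    and eq: "t\<^sub>1 \<otimes> r\<^sub>1 = t\<^sub>2 \<otimes> r\<^sub>2" "t\<^sub>1 \<otimes> q\<^sub>1 = t\<^sub>2 \<otimes> q\<^sub>2" "t\<^sub>1 \<otimes> r\<^sub>1 \<otimes> s = t\<^sub>1 \<otimes> q\<^sub>1 \<otimes> s'"
    and ne: "t\<^sub>1 \<noteq> t\<^sub>2" "r\<^sub>1 \<noteq> q\<^sub>1"
  shows "t\<^sub>1 \<otimes> r\<^sub>1 \<otimes> s \<in> reflections W S"
proof (cases "r\<^sub>1 = t\<^sub>1")
  case True
  then show ?thesis using T by (simp add: absolute.gens_involution)
next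
  case False
  have C: "t\<^sub>1 \<in> carrier W" "t\<^sub>2 \<in> carrier W" "r\<^sub>1 \<in> carrier W" "r\<^sub>2 \<in> carrier W"
      "q\<^sub>1 \<in> carrier W" "q\<^sub>2 \<in> carrier W" "s \<in> carrier W" "s' \<in> carrier W"
    using T by auto
  \<comment> \<open>Hence \<open>(r\<^sub>1, r\<^sub>2)\<close> and
    \<open>(q\<^sub>1, q\<^sub>2)\<close> are two further factorisations of
    \<open>t\<^sub>1 \<otimes> t\<^sub>2\<close> into distinct reflections.\<close>
  have swap: "x \<otimes> x' = t\<^sub>1 \<otimes> t\<^sub>2" "x \<noteq> x'"
    if "t\<^sub>1 \<otimes> x = t\<^sub>2 \<otimes> x'" "x \<in> reflections W S" "x' \<in> reflections W S" for x x'
  proof -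
    have "x = t\<^sub>1 \<otimes> (t\<^sub>2 \<otimes> x')" using that T by (metis absolute.gen_cancel_left absolute.gen_in_carrier)
    then show "x \<otimes> x' = t\<^sub>1 \<otimes> t\<^sub>2"
      using that T by (simp add: m_assoc absolute.gens_involution)
    show "x \<noteq> x'" using that ne(1) C by (metis absolute.gen_in_carrier right_cancel)
  qed
  have "r\<^sub>1 \<otimes> s = q\<^sub>1 \<otimes> s'" using eq(3) C by (simp add: m_assoc)
  then have "s = r\<^sub>1 \<otimes> (q\<^sub>1 \<otimes> s')" using T C by (metis absolute.gen_cancel_left)
  then have ss': "s \<otimes> s' = r\<^sub>1 \<otimes> q\<^sub>1"
    using T C by (simp add: m_assoc absolute.gens_involution)
  have "s \<noteq> s'"
  proof
    assume "s = s'"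
    then have "r\<^sub>1 \<otimes> q\<^sub>1 = r\<^sub>1 \<otimes> r\<^sub>1" using ss' T by (simp add: absolute.gens_involution)
    then show False using ne(2) C by simp
  qed
  obtain a\<^sub>1 where a1: "flat a\<^sub>1" "form a\<^sub>1 a\<^sub>1 = 1" "rep t\<^sub>1 = geo.refl a\<^sub>1"
    using reflection_root[OF T(1)] by blast
  obtain a\<^sub>2 where a2: "flat a\<^sub>2" "form a\<^sub>2 a\<^sub>2 = 1" "rep t\<^sub>2 = geo.refl a\<^sub>2"
    using reflection_root[OF T(2)] by blast
  obtain b\<^sub>1 where b1: "flat b\<^sub>1" "form b\<^sub>1 b\<^sub>1 = 1" "rep r\<^sub>1 = geo.refl b\<^sub>1"
    using reflection_root[OF T(3)] by blast
  obtain b\<^sub>2 where b2: "flat b\<^sub>2" "form b\<^sub>2 b\<^sub>2 = 1" "rep r\<^sub>2 = geo.refl b\<^sub>2"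
    using reflection_root[OF T(4)] by blast
  obtain c\<^sub>1 where c1: "flat c\<^sub>1" "form c\<^sub>1 c\<^sub>1 = 1" "rep q\<^sub>1 = geo.refl c\<^sub>1"
    using reflection_root[OF T(5)] by blast
  obtain c\<^sub>2 where c2: "flat c\<^sub>2" "form c\<^sub>2 c\<^sub>2 = 1" "rep q\<^sub>2 = geo.refl c\<^sub>2"
    using reflection_root[OF T(6)] by blast
  obtain d where d1: "flat d" "form d d = 1" "rep s = geo.refl d"
    using reflection_root[OF T(7)] by blast
  obtain d' where d2: "flat d'" "form d' d' = 1" "rep s' = geo.refl d'"
    using reflection_root[OF T(8)] by blast
  note flat = a1(1) a2(1) b1(1) b2(1) c1(1) c2(1) d1(1) d2(1)
  note unit = a1(2) a2(2) b1(2) b2(2) c1(2) c2(2) d1(2) d2(2)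
  note rep = a1(3) a2(3) b1(3) b2(3) c1(3) c2(3) d1(3) d2(3)
  obtain p q where b: "b\<^sub>1 = p *\<^sub>R a\<^sub>1 + q *\<^sub>R a\<^sub>2"
    using reflection_product_eq[OF C(1,2,3,4) rep(1,2,3,4) unit(3,4) flat(3,4)] swap[OF eq(1) T(3,4)]
    by blast
  obtain p' q' where c: "c\<^sub>1 = p' *\<^sub>R a\<^sub>1 + q' *\<^sub>R a\<^sub>2"
    using reflection_product_eq[OF C(1,2,5,6) rep(1,2,5,6) unit(5,6) flat(5,6)] swap[OF eq(2) T(5,6)]
    by blast
  obtain p'' q'' where d: "d = p'' *\<^sub>R b\<^sub>1 + q'' *\<^sub>R c\<^sub>1"
    using reflection_product_eq[OF C(3,5,7,8) rep(3,5,7,8) unit(7,8) flat(7,8)] ss' \<open>s \<noteq> s'\<close>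
    by blast
  \<comment> \<open>As \<open>r\<^sub>1 \<noteq> t\<^sub>1\<close>, the vectors
    \<open>a\<^sub>1\<close> and \<open>b\<^sub>1\<close> are not parallel and
    \<open>a\<^sub>2\<close> can be eliminated. This writes \<open>d\<close> in the roots of the
    first two factors, as \<open>refl_coplanar\<close> requires.\<close>
  have "q \<noteq> 0"
    using b reflection_roots_independent[OF C(3,1) rep(3,1) unit(3,1) False, of p] by auto
  then have "a\<^sub>2 = (1 / q) *\<^sub>R b\<^sub>1 + (- p / q) *\<^sub>R a\<^sub>1"
    by (simp add: b scaleR_add_right)
  then have "c\<^sub>1 = p' *\<^sub>R a\<^sub>1 + q' *\<^sub>R ((1 / q) *\<^sub>R b\<^sub>1 + (- p / q) *\<^sub>R a\<^sub>1)" using c by simp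
  then have "d = p'' *\<^sub>R b\<^sub>1 + q'' *\<^sub>R (p' *\<^sub>R a\<^sub>1 + q' *\<^sub>R ((1 / q) *\<^sub>R b\<^sub>1 + (- p / q) *\<^sub>R a\<^sub>1))"
    using d by simp
  then have "d = (q'' * (p' + q' * (- p / q))) *\<^sub>R a\<^sub>1 + (p'' + q'' * (q' * (1 / q))) *\<^sub>R b\<^sub>1"
    by (simp only: scaleR_add_right scaleR_add_left scaleR_scaleR distrib_left add_ac)
  then obtain e where "form e e = 1" "geo.refl a\<^sub>1 \<circ> geo.refl b\<^sub>1 \<circ> geo.refl d = geo.refl e"
    using geo.refl_coplanar[OF unit(1,3)] unit(7) by metis
  then show ?thesis
    using rep C by (intro reflection_if_rep[of _ e]) (simp_all add: rep_mult)
qed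

section \<open>Intervals of the absolute order\<close>

lemma absolute_le_prefix: "absolute_le W S = absolute.prefix_le"
  by (auto simp: fun_eq_iff absolute_le_def reflection_length_def absolute.prefix_le_def)

lemma absolute_interval_prefix: "absolute_interval W S u v = absolute.prefix_interval u v"
  by (simp add: absolute_interval_def absolute.prefix_interval_def absolute_le_prefix)

text \<open>The rank is only bounded by three, so that for a Coxeter element the upper bound
  \<open>card S\<close> on its reflection length is enough.\<close>

lemma lattice_absolute_interval:
  assumes "u \<in> carrier W" "v \<in> carrier W" "absolute_le W S u v"
    and "reflection_length W S v \<le> reflection_length W S u + 3"
  shows "lattice (absolute_interval W S u v)"
  unfolding absolute_interval_prefix
proof (rule absolute.lattice_prefix_interval[OF assms(1,2)])
  show "absolute.prefix_le u v" using assms(3) by (simp add: absolute_le_prefix)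
  show "absolute.len v \<le> absolute.len u + 3" using assms(4) by (simp add: reflection_length_def)
  fix a b w w'
  assume C: "a \<in> carrier W" "b \<in> carrier W" "w \<in> carrier W" "w' \<in> carrier W"
    and le: "absolute.prefix_le u a" "absolute.prefix_le u b"
      "absolute.prefix_le a w" "absolute.prefix_le b w"
      "absolute.prefix_le a w'" "absolute.prefix_le b w'"
      "absolute.prefix_le w v" "absolute.prefix_le w' v"
    and len: "absolute.len a = Suc (absolute.len u)" "absolute.len b = Suc (absolute.len u)"
      "absolute.len w = Suc (Suc (absolute.len u))" "absolute.len w' = Suc (Suc (absolute.len u))"
      "absolute.len v = Suc (Suc (Suc (absolute.len u)))"
    and ab: "a \<noteq> b"
  note cover = absolute.prefix_le_cover
  obtain t\<^sub>1 where t1: "t\<^sub>1 \<in> reflections W S" "a = u \<otimes> t\<^sub>1" using cover[OF assms(1) C(1) le(1)] len by auto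
  obtain t\<^sub>2 where t2: "t\<^sub>2 \<in> reflections W S" "b = u \<otimes> t\<^sub>2" using cover[OF assms(1) C(2) le(2)] len by auto
  obtain r\<^sub>1 where r1: "r\<^sub>1 \<in> reflections W S" "w = a \<otimes> r\<^sub>1" using cover[OF C(1,3) le(3)] len by auto
  obtain r\<^sub>2 where r2: "r\<^sub>2 \<in> reflections W S" "w = b \<otimes> r\<^sub>2" using cover[OF C(2,3) le(4)] len by auto
  obtain q\<^sub>1 where q1: "q\<^sub>1 \<in> reflections W S" "w' = a \<otimes> q\<^sub>1" using cover[OF C(1,4) le(5)] len by auto
  obtain q\<^sub>2 where q2: "q\<^sub>2 \<in> reflections W S" "w' = b \<otimes> q\<^sub>2" using cover[OF C(2,4) le(6)] len by auto
  obtain s where s: "s \<in> reflections W S" "v = w \<otimes> s" using cover[OF C(3) assms(2) le(7)] len by auto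
  obtain s' where s': "s' \<in> reflections W S" "v = w' \<otimes> s'" using cover[OF C(4) assms(2) le(8)] len by auto
  note T = t1 t2 r1 r2 q1 q2 s s'
  note T' = T(1,3,5,7,9,11,13,15)[THEN absolute.gen_in_carrier]
  show "w = w'"
  proof (rule ccontr)
    assume ww: "w \<noteq> w'"
    have "u \<otimes> (t\<^sub>1 \<otimes> r\<^sub>1) = u \<otimes> (t\<^sub>2 \<otimes> r\<^sub>2)" "u \<otimes> (t\<^sub>1 \<otimes> q\<^sub>1) = u \<otimes> (t\<^sub>2 \<otimes> q\<^sub>2)"
      "u \<otimes> (t\<^sub>1 \<otimes> r\<^sub>1 \<otimes> s) = u \<otimes> (t\<^sub>1 \<otimes> q\<^sub>1 \<otimes> s')"
      using T T' assms(1) by (metis m_assoc m_closed)+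
    then have eq: "t\<^sub>1 \<otimes> r\<^sub>1 = t\<^sub>2 \<otimes> r\<^sub>2" "t\<^sub>1 \<otimes> q\<^sub>1 = t\<^sub>2 \<otimes> q\<^sub>2" "t\<^sub>1 \<otimes> r\<^sub>1 \<otimes> s = t\<^sub>1 \<otimes> q\<^sub>1 \<otimes> s'"
      using T' assms(1) by simp_all
    have "t\<^sub>1 \<noteq> t\<^sub>2" "r\<^sub>1 \<noteq> q\<^sub>1" using ab ww t1 t2 r1 q1 by blast+
    then have "t\<^sub>1 \<otimes> r\<^sub>1 \<otimes> s \<in> reflections W S"
      by (rule reflection_if_crossing[OF T(1,3,5,7,9,11,13,15) eq])
    \<comment> \<open>A single reflection raises the length by at most one, whereas \<open>v\<close>
      lies three above \<open>u\<close>.\<close>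
    then have "absolute.len (u \<otimes> (t\<^sub>1 \<otimes> r\<^sub>1 \<otimes> s)) \<le> Suc (absolute.len u)"
      using absolute.len_mult_gen assms(1) by blast
    moreover have "v = u \<otimes> (t\<^sub>1 \<otimes> r\<^sub>1 \<otimes> s)" using T T' assms(1) by (simp add: m_assoc)
    ultimately show False using len(5) by simp
  qed
qed

lemma coxeter_element_length:
  assumes "coxeter_element W S c"
  shows "c \<in> carrier W" "reflection_length W S c \<le> card S"
proof -
  obtain xs where xs: "distinct xs" "set xs = S" "c = list_product W xs"
    using assms by (auto simp: coxeter_element_def list_product_def)
  then show "c \<in> carrier W" by simp
  have "set xs \<subseteq> reflections W S" using xs simple_reflection by blast
  then show "reflection_length W S c \<le> card S"
    using absolute.len_le xs distinct_card unfolding reflection_length_def by metis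
qed

end

theorem theorem2p2:
  fixes W :: "('a, 'b) monoid_scheme" and S :: "'a set"
  assumes "coxeter_system W S"
  shows "(\<forall>u \<in> carrier W. \<forall>v \<in> carrier W.
            absolute_le W S u v \<and> reflection_length W S v = reflection_length W S u + 3
            \<longrightarrow> lattice (absolute_interval W S u v))
       \<and> (card S = 3 \<longrightarrow>
            (\<forall>c. coxeter_element W S c \<longrightarrow> lattice (absolute_interval W S \<one>\<^bsub>W\<^esub> c)))"
proof -
  interpret coxeter_system W S by fact
  have "lattice (absolute_interval W S \<one>\<^bsub>W\<^esub> c)" if "card S = 3" "coxeter_element W S c" for c
    using coxeter_element_length[OF that(2)] that(1)
    by (intro lattice_absolute_interval) (auto simp: absolute_le_prefix absolute.prefix_le_one)
  then show ?thesis using lattice_absolute_interval by simp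
qed

end
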